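(* Let $\mathcal{L}$ be a Lie algebra over a (commutative) field $\mathbb{K}$ of characteristic zero, let $\mathcal{U}(\mathcal{L})$ be its universal enveloping algebra, and let $\{X_1,\ldots,X_n\}$ be a basis of $\mathcal{L}$. For an $n$-tuple $(\alpha)=(\alpha_1,\ldots,\alpha_n)$ of integers $\geq 0$ set $X^{(\alpha)}=X_1^{\alpha_1}\cdots X_n^{\alpha_n}$, $\tilde{X}^{(\alpha)}=\operatorname{Sym}(X^{(\alpha)})$ and $|(\alpha)|=\alpha_1+\cdots+\alpha_n$. Then the set $\{\tilde{X}^{(\alpha)}\}_{(\alpha)}$, for all $(\alpha)$ such that $|(\alpha)|\geq 0$, forms a vector space basis for $\mathcal{U}(\mathcal{L})$. Moreover, if for each $n$-tuple $(\alpha)$ of integers $\ge 0$ one chooses one monomial $X_{i_1}\cdots X_{i_m}$ ($m=|(\alpha)|$, $1\leq i_j\leq n$, $1\leq j\leq m$) equipollent to $X^{(\alpha)}$, then the set of all the chosen monomials is a basis of $\mathcal{U}(\mathcal{L})$; in particular, the set of ordered monomials $\{X^{(\alpha)} : |(\alpha)|\geq 0\}$ forms a basis for $\mathcal{U}(\mathcal{L})$.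
   Context: The universal enveloping algebra is $\mathcal{U}(\mathcal{L})=\mathcal{T}/J$, where $\mathcal{T}$ is the tensor algebra of the vector space $\mathcal{L}$ and $J$ is the two-sided ideal generated by all $X\otimes Y-Y\otimes X-[X,Y]$ with $X,Y\in\mathcal{L}$. Equivalently, let $\mathcal{A}$ be the algebra of non-commutative polynomials in $X_1,\ldots,X_n$ with coefficients in $\mathbb{K}$ (elements of $\mathcal{L}$ are identified with homogeneous polynomials of degree one); then $\mathcal{U}(\mathcal{L})$ is the quotient of $\mathcal{A}$ by the linear span of all elements $P(XY-YX-[X,Y])Q$ with $P,Q\in\mathcal{A}$, $X,Y\in\mathcal{L}$. Monomials and polynomials in the $X_i$ are regarded as elements of $\mathcal{U}(\mathcal{L})$ via their images in this quotient. Two non-commutative monomials are equipollent if they differ only by the order of their factors. For $(\alpha)$ with $|(\alpha)|=m$, write the ordered monomial $X^{(\alpha)}=X'_1X'_2\cdots X'_m$ with each $X'_j\in\{X_1,\ldots,X_n\}$ (the first $\alpha_1$ factors are $X_1$, the next $\alpha_2$ are $X_2$, and so on). Then $$\operatorname{Sym}(X^{(\alpha)})=\frac{1}{m!}\sum_{\sigma\in\Sigma_m}X'_{\sigma(1)}\cdots X'_{\sigma(m)},$$ where $\Sigma_m$ is the symmetric group on $m$ letters. *)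

theory Defs
  imports
    "HOL-Library.Poly_Mapping"
    "HOL-Library.FuncSet"
    "HOL-Combinatorics.Permutations"
    "HOL-Algebra.QuotRing"
    "Jordan_Normal_Form.VS_Connect"
begin

section \<open>Lie algebras with a finite basis\<close>

locale lie_algebra = vector_space scale
  for scale :: "'k::field \<Rightarrow> 'l::ab_group_add \<Rightarrow> 'l" +
  fixes bracket :: "'l \<Rightarrow> 'l \<Rightarrow> 'l"
  assumes bracket_add_left: "bracket (x + y) z = bracket x z + bracket y z"
    and bracket_add_right: "bracket x (y + z) = bracket x y + bracket x z"
    and bracket_scale_left: "bracket (scale c x) y = scale c (bracket x y)"
    and bracket_scale_right: "bracket x (scale c y) = scale c (bracket x y)"
    and bracket_self: "bracket x x = 0"
    and jacobi: "bracket x (bracket y z) + bracket y (bracket z x) + bracket z (bracket x y) = 0"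

text \<open>The basis is \<open>X 1, \<dots>, X n\<close>; the values of \<^term>\<open>X\<close> outside \<open>{1..n}\<close> are irrelevant.\<close>

locale lie_algebra_basis = lie_algebra scale bracket
  for scale :: "'k::field \<Rightarrow> 'l::ab_group_add \<Rightarrow> 'l" and bracket +
  fixes n :: nat and X :: "nat \<Rightarrow> 'l"
  assumes inj_X: "inj_on X {1..n}"
    and independent_X: "independent (X ` {1..n})"
    and span_X: "span (X ` {1..n}) = UNIV"


section \<open>Non-commutative polynomials\<close>

text \<open>A monomial is the list of the indices of its factors. With concatenation of lists as the
  monoid operation, the convolution product of \<^theory>\<open>HOL-Library.Poly_Mapping\<close> is the product
  of the free associative algebra.\<close>

instantiation list :: (type) monoid_add
begin

definition zero_list :: "'a list" where "zero_list = []"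

definition plus_list :: "'a list \<Rightarrow> 'a list \<Rightarrow> 'a list" where "plus_list u v = u @ v"

instance by standard (simp_all add: zero_list_def plus_list_def)

end

type_synonym 'k ncpoly = "nat list \<Rightarrow>\<^sub>0 'k"

definition monomial :: "nat list \<Rightarrow> 'k::field ncpoly" where
  "monomial w = Poly_Mapping.single w 1"

definition ncpoly_smult :: "'k::field \<Rightarrow> 'k ncpoly \<Rightarrow> 'k ncpoly" where
  "ncpoly_smult c p = Poly_Mapping.map ((*) c) p"

definition ncpoly_algebra :: "nat \<Rightarrow> ('k::field, 'k ncpoly) module" where
  "ncpoly_algebra n =
    \<lparr>carrier = {p. Poly_Mapping.keys p \<subseteq> lists {1..n}},
     mult = (*), one = 1, zero = 0, add = (+), smult = ncpoly_smult\<rparr>"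

definition equipollent :: "nat list \<Rightarrow> nat list \<Rightarrow> bool" where
  "equipollent u v \<longleftrightarrow> mset u = mset v"

definition multi_indices :: "nat \<Rightarrow> (nat \<Rightarrow> nat) set" where
  "multi_indices n = ({1..n} \<rightarrow>\<^sub>E UNIV)"

definition ordered_word :: "nat \<Rightarrow> (nat \<Rightarrow> nat) \<Rightarrow> nat list" where
  "ordered_word n \<alpha> = concat (map (\<lambda>i. replicate (\<alpha> i) i) [1..<Suc n])"

definition Sym :: "nat list \<Rightarrow> 'k::field_char_0 ncpoly" where
  "Sym w = ncpoly_smult (1 / fact (length w))
    (\<Sum>\<sigma> | \<sigma> permutes {..<length w}. monomial (permute_list \<sigma> w))"

lemma zero_list_eq [simp]: "(0::'a list) = []"
  by (simp add: zero_list_def)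

lemma plus_list_eq [simp]: "(u::'a list) + v = u @ v"
  by (simp add: plus_list_def)

lemma ncpoly_smult_conv_mult: "ncpoly_smult c p = Poly_Mapping.single [] c * p"
  unfolding ncpoly_smult_def by (metis mult_map_scale_conv_mult zero_list_def)

lemma mult_ncpoly_smult: "p * ncpoly_smult c q = ncpoly_smult c (p * q)"
proof -
  have "p * Poly_Mapping.single [] c = Poly_Mapping.single [] c * p"
  proof (induction p rule: update_induct)
    case (update f w a)
    have "Poly_Mapping.update w a f = f + Poly_Mapping.single w a"
      using update by (auto simp: update.rep_eq lookup_add lookup_single when_def in_keys_iff
          intro!: poly_mapping_eqI)
    then show ?case using update by (simp add: mult_single algebra_simps)
  qed simp
  then show ?thesis by (metis ncpoly_smult_conv_mult mult.assoc)
qed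

lemma lookup_ncpoly_smult [simp]:
  "Poly_Mapping.lookup (ncpoly_smult c p) w = c * Poly_Mapping.lookup p w"
  unfolding ncpoly_smult_def by (simp add: Poly_Mapping.map.rep_eq when_def)

lemma ncpoly_smult_simps:
  "ncpoly_smult (c + d) p = ncpoly_smult c p + ncpoly_smult d p"
  "ncpoly_smult c (p + q) = ncpoly_smult c p + ncpoly_smult c q"
  "ncpoly_smult (c * d) p = ncpoly_smult c (ncpoly_smult d p)"
  "ncpoly_smult 1 p = p"
  by (auto intro!: poly_mapping_eqI simp: lookup_add algebra_simps)

lemma monomial_Nil: "monomial [] = 1"
  unfolding monomial_def by (metis single_one zero_list_def)

lemma monomial_append: "monomial (u @ v) = monomial u * monomial v"
  by (simp add: monomial_def mult_single)

lemma monomial_ordered_word: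
  "(monomial (ordered_word n \<alpha>) :: 'a::field ncpoly) = (\<Prod>i\<leftarrow>[1..<Suc n]. monomial [i] ^ \<alpha> i)"
proof -
  have rep: "(monomial (replicate k i) :: 'a ncpoly) = monomial [i] ^ k" for k i
  proof (induction k)
    case (Suc k)
    then show ?case using monomial_append[of "[i]" "replicate k i", where 'a = 'a] by simp
  qed (simp add: monomial_Nil)
  have "monomial (concat (map (\<lambda>i. replicate (\<alpha> i) i) is)) =
    ((\<Prod>i\<leftarrow>is. monomial [i] ^ \<alpha> i) :: 'a ncpoly)" for "is"
    by (induction "is") (simp_all add: monomial_Nil monomial_append rep)
  then show ?thesis by (simp add: ordered_word_def)
qed

lemma carrier_ncpoly_algebra:
  "p \<in> carrier (ncpoly_algebra n) \<longleftrightarrow> Poly_Mapping.keys p \<subseteq> lists {1..n}"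
  by (simp add: ncpoly_algebra_def)

lemma keys_ncpoly_mult:
  assumes "Poly_Mapping.keys p \<subseteq> lists A" "Poly_Mapping.keys q \<subseteq> lists A"
  shows "Poly_Mapping.keys (p * q) \<subseteq> lists A"
proof
  fix w assume "w \<in> Poly_Mapping.keys (p * q)"
  then obtain u v where "w = u @ v" "u \<in> Poly_Mapping.keys p" "v \<in> Poly_Mapping.keys q"
    using keys_mult[of p q] by auto
  then show "w \<in> lists A" using assms by auto
qed

lemma keys_one_ncpoly: "Poly_Mapping.keys (1 :: 'k::field ncpoly) = {[]}"
  by (metis keys_single single_one zero_list_def zero_neq_one)

lemma ring_ncpoly_algebra: "ring (ncpoly_algebra n :: ('k::field, 'k ncpoly) module)"
proof (rule ringI)
  show "abelian_group (ncpoly_algebra n :: ('k, 'k ncpoly) module)"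
  proof (rule abelian_groupI, goal_cases)
    case (6 p)
    then show ?case
      by (intro bexI[of _ "- p"]) (simp_all add: ncpoly_algebra_def)
  qed (use keys_add in \<open>fastforce simp: ncpoly_algebra_def algebra_simps\<close>)+
  show "monoid (ncpoly_algebra n :: ('k, 'k ncpoly) module)"
    by (rule monoidI)
      (simp_all add: ncpoly_algebra_def keys_ncpoly_mult mult.assoc keys_one_ncpoly)
qed (simp_all add: ncpoly_algebra_def algebra_simps)

lemma vectorspace_ncpoly_algebra:
  "vectorspace class_ring (ncpoly_algebra n :: ('k::field, 'k ncpoly) module)"
proof -
  have "module class_ring (ncpoly_algebra n :: ('k, 'k ncpoly) module)"
  proof (rule moduleI)
    show "cring (class_ring :: 'k ring)" by (rule class_cring.is_cring)
    show "abelian_group (ncpoly_algebra n :: ('k, 'k ncpoly) module)"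
      using ring_ncpoly_algebra by (rule ring.is_abelian_group)
  qed (auto simp: ncpoly_algebra_def in_keys_iff algebra_simps lookup_add intro!: poly_mapping_eqI)
  then show ?thesis by (rule vectorspace.intro) (rule class_field.field_axioms)
qed


section \<open>The universal enveloping algebra\<close>

context lie_algebra_basis
begin

text \<open>The identification of the Lie algebra with the homogeneous polynomials of degree one, which
  sends \<open>X i\<close> to the \<open>i\<close>-th variable.\<close>

definition lie_embed :: "'l \<Rightarrow> 'k ncpoly" where
  "lie_embed x = (\<Sum>i\<in>{1..n}. ncpoly_smult (representation (X ` {1..n}) x (X i)) (monomial [i]))"

definition relators :: "'k ncpoly set" where
  "relators = {P * (lie_embed x * lie_embed y - lie_embed y * lie_embed x - lie_embed (bracket x y)) * Q | P Q x y.
     P \<in> carrier (ncpoly_algebra n) \<and> Q \<in> carrier (ncpoly_algebra n)}"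

definition relation_ideal :: "'k ncpoly set" where
  "relation_ideal = LinearCombinations.module.span class_ring (ncpoly_algebra n) relators"

text \<open>The quotient ring of cosets of the relation ideal, together with its scalar
  multiplication.\<close>

definition UEA :: "('k, 'k ncpoly set) module" where
  "UEA = (let A = ncpoly_algebra n; I = relation_ideal; U = A Quot I in
    \<lparr>carrier = carrier U, mult = mult U, one = one U, zero = zero U, add = add U,
     smult = (\<lambda>c C. \<Union>p\<in>C. I +>\<^bsub>A\<^esub> (c \<odot>\<^bsub>A\<^esub> p))\<rparr>)"

definition to_UEA :: "'k ncpoly \<Rightarrow> 'k ncpoly set" where
  "to_UEA p = relation_ideal +>\<^bsub>ncpoly_algebra n\<^esub> p"

lemma lie_embed_X:
  assumes "i \<in> {1..n}"
  shows "lie_embed (X i) = monomial [i]"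
proof -
  have "representation (X ` {1..n}) (X i) (X j) = (if j = i then 1 else 0)" if "j \<in> {1..n}" for j
    using assms that independent_X inj_X by (auto simp: representation_basis inj_on_eq_iff)
  then have "lie_embed (X i) =
    (\<Sum>j\<in>{1..n}. ncpoly_smult (if j = i then 1 else 0) (monomial [j]))"
    unfolding lie_embed_def by (intro sum.cong) auto
  also have "\<dots> = (\<Sum>j\<in>{1..n}. if j = i then monomial [j] else 0)"
    by (intro sum.cong) (auto simp: ncpoly_smult_conv_mult ncpoly_smult_simps(4)[unfolded ncpoly_smult_conv_mult])
  also have "\<dots> = monomial [i]" using assms by simp
  finally show ?thesis .
qed

lemma lie_embed_in_carrier: "lie_embed x \<in> carrier (ncpoly_algebra n)"
proof -
  have "Poly_Mapping.keys (lie_embed x) \<subseteq>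
    (\<Union>i\<in>{1..n}. Poly_Mapping.keys
      (ncpoly_smult (representation (X ` {1..n}) x (X i)) (monomial [i])))"
    unfolding lie_embed_def by (rule keys_sum)
  also have "\<dots> \<subseteq> lists {1..n}"
    by (auto simp: in_keys_iff monomial_def lookup_single when_def split: if_splits)
  finally show ?thesis by (simp add: carrier_ncpoly_algebra)
qed

lemma relators_subset_carrier: "relators \<subseteq> carrier (ncpoly_algebra n)"
proof -
  interpret A: ring "ncpoly_algebra n :: ('k, 'k ncpoly) module" by (rule ring_ncpoly_algebra)
  have diff: "p - q \<in> carrier (ncpoly_algebra n)"
    if "p \<in> carrier (ncpoly_algebra n)" "q \<in> carrier (ncpoly_algebra n)" for p q :: "'k ncpoly"
    using that keys_diff[of p q] by (auto simp: carrier_ncpoly_algebra)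
  have mult: "p * q \<in> carrier (ncpoly_algebra n)"
    if "p \<in> carrier (ncpoly_algebra n)" "q \<in> carrier (ncpoly_algebra n)" for p q :: "'k ncpoly"
    using that by (simp add: carrier_ncpoly_algebra keys_ncpoly_mult)
  show ?thesis by (auto simp: relators_def intro!: mult diff lie_embed_in_carrier)
qed

lemma ideal_relation_ideal: "ideal relation_ideal (ncpoly_algebra n)"
proof -
  let ?A = "ncpoly_algebra n :: ('k, 'k ncpoly) module"
  interpret A: ring ?A by (rule ring_ncpoly_algebra)
  interpret V: vectorspace "class_ring :: 'k ring" ?A by (rule vectorspace_ncpoly_algebra)
  have sub: "submodule class_ring relation_ideal ?A"
    unfolding relation_ideal_def by (rule V.span_is_submodule[OF relators_subset_carrier])
  have mem: "r \<in> relation_ideal" if "r \<in> relators" for r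
    using V.in_own_span[OF relators_subset_carrier] that by (auto simp: relation_ideal_def)
  have left: "p * r \<in> relators" if "p \<in> carrier ?A" "r \<in> relators" for p r
  proof -
    obtain P Q x y where r: "r = P * (lie_embed x * lie_embed y - lie_embed y * lie_embed x - lie_embed (bracket x y)) * Q"
      and PQ: "P \<in> carrier ?A" "Q \<in> carrier ?A"
      using \<open>r \<in> relators\<close> by (auto simp: relators_def)
    have "p * r = (p * P) * (lie_embed x * lie_embed y - lie_embed y * lie_embed x - lie_embed (bracket x y)) * Q"
      by (simp add: r mult.assoc)
    moreover have "p * P \<in> carrier ?A"
      using that PQ by (simp add: carrier_ncpoly_algebra keys_ncpoly_mult)
    ultimately show ?thesis using PQ unfolding relators_def by blast
  qed
  have right: "r * p \<in> relators" if "p \<in> carrier ?A" "r \<in> relators" for p r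
  proof -
    obtain P Q x y where r: "r = P * (lie_embed x * lie_embed y - lie_embed y * lie_embed x - lie_embed (bracket x y)) * Q"
      and PQ: "P \<in> carrier ?A" "Q \<in> carrier ?A"
      using \<open>r \<in> relators\<close> by (auto simp: relators_def)
    have "r * p = P * (lie_embed x * lie_embed y - lie_embed y * lie_embed x - lie_embed (bracket x y)) * (Q * p)"
      by (simp add: r mult.assoc)
    moreover have "Q * p \<in> carrier ?A"
      using that PQ by (simp add: carrier_ncpoly_algebra keys_ncpoly_mult)
    ultimately show ?thesis using PQ unfolding relators_def by blast
  qed
  have closed: "h a \<in> relation_ideal"
    if a: "a \<in> relation_ideal" and rel: "\<And>r. r \<in> relators \<Longrightarrow> h r \<in> relators"
      and car: "\<And>q. q \<in> carrier ?A \<Longrightarrow> h q \<in> carrier ?A" and zero: "h 0 = 0"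
      and add: "\<And>q q'. h (q + q') = h q + h q'"
      and scale: "\<And>c q. h (ncpoly_smult c q) = ncpoly_smult c (h q)"
    for h :: "'k ncpoly \<Rightarrow> 'k ncpoly" and a
  proof -
    let ?S = "{q \<in> carrier ?A. h q \<in> relation_ideal}"
    have "submodule class_ring ?S ?A"
    proof
      show "?S \<subseteq> carrier ?A" by auto
      show "v \<oplus>\<^bsub>?A\<^esub> w \<in> ?S" if "v \<in> ?S" "w \<in> ?S" for v w
        using that A.a_closed[of v w] submodule.m_closed[OF sub, of "h v" "h w"]
        by (auto simp: ncpoly_algebra_def add)
      show "\<zero>\<^bsub>?A\<^esub> \<in> ?S"
        using submodule.zero_closed[OF sub] by (auto simp: ncpoly_algebra_def zero)
      show "c \<odot>\<^bsub>?A\<^esub> v \<in> ?S" if "v \<in> ?S" for c v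
        using that V.smult_closed[of c v] submodule.smult_closed[OF sub, of c "h v"]
        by (auto simp: ncpoly_algebra_def scale)
    qed
    moreover have "relators \<subseteq> ?S" using relators_subset_carrier rel mem by auto
    ultimately have "relation_ideal \<subseteq> ?S"
      unfolding relation_ideal_def using V.span_is_subset by blast
    then show ?thesis using a by auto
  qed
  show ?thesis
  proof (rule idealI)
    show "ring ?A" by (rule ring_ncpoly_algebra)
    show "subgroup relation_ideal (add_monoid ?A)"
    proof (rule A.add.subgroupI)
      show "relation_ideal \<subseteq> carrier ?A" using submodule.subset[OF sub] .
      show "relation_ideal \<noteq> {}" using submodule.zero_closed[OF sub] by auto
      show "a \<oplus>\<^bsub>?A\<^esub> b \<in> relation_ideal" if "a \<in> relation_ideal" "b \<in> relation_ideal" for a b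
        using that submodule.m_closed[OF sub] by auto
      show "\<ominus>\<^bsub>?A\<^esub> a \<in> relation_ideal" if "a \<in> relation_ideal" for a
      proof -
        have a: "a \<in> carrier ?A" using that submodule.subset[OF sub] by auto
        then have "- a \<in> carrier ?A" by (simp add: carrier_ncpoly_algebra)
        then have "\<ominus>\<^bsub>?A\<^esub> a = - a"
          using a by (intro A.minus_equality) (auto simp: ncpoly_algebra_def)
        also have "\<dots> = (-1) \<odot>\<^bsub>?A\<^esub> a"
          by (auto simp: ncpoly_algebra_def intro!: poly_mapping_eqI)
        finally show ?thesis using submodule.smult_closed[OF sub, of "-1" a] that by simp
      qed
    qed
    show "x \<otimes>\<^bsub>?A\<^esub> a \<in> relation_ideal" if "a \<in> relation_ideal" "x \<in> carrier ?A" for a x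
      using that left keys_ncpoly_mult[of x "{1..n}"]
      by (auto simp: ncpoly_algebra_def algebra_simps mult_ncpoly_smult intro!: closed[of a "(*) x"])
    show "a \<otimes>\<^bsub>?A\<^esub> x \<in> relation_ideal" if "a \<in> relation_ideal" "x \<in> carrier ?A" for a x
      using that right keys_ncpoly_mult[of _ "{1..n}" x]
      by (auto simp: ncpoly_algebra_def algebra_simps ncpoly_smult_conv_mult mult.assoc
          intro!: closed[of a "\<lambda>q. q * x"])
  qed
qed

lemma UEA_sel:
  "carrier UEA = carrier (ncpoly_algebra n Quot relation_ideal)"
  "mult UEA = mult (ncpoly_algebra n Quot relation_ideal)"
  "one UEA = one (ncpoly_algebra n Quot relation_ideal)"
  "zero UEA = zero (ncpoly_algebra n Quot relation_ideal)"
  "add UEA = add (ncpoly_algebra n Quot relation_ideal)"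
  by (simp_all add: UEA_def Let_def)

lemma carrier_UEA: "carrier UEA = to_UEA ` carrier (ncpoly_algebra n)"
  by (auto simp: UEA_sel to_UEA_def FactRing_def A_RCOSETS_def' a_r_coset_def')

lemma to_UEA_hom: "to_UEA \<in> Ring.ring_hom (ncpoly_algebra n) UEA"
proof -
  have "(+>\<^bsub>ncpoly_algebra n\<^esub>) relation_ideal
    \<in> Ring.ring_hom (ncpoly_algebra n) (ncpoly_algebra n Quot relation_ideal)"
    using ideal_relation_ideal by (rule ideal.rcos_ring_hom)
  moreover have "to_UEA = (+>\<^bsub>ncpoly_algebra n\<^esub>) relation_ideal"
    by (simp add: fun_eq_iff to_UEA_def)
  ultimately show ?thesis by (simp add: Ring.ring_hom_def UEA_sel)
qed

lemma to_UEA_add: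
  "p \<in> carrier (ncpoly_algebra n) \<Longrightarrow> q \<in> carrier (ncpoly_algebra n) \<Longrightarrow>
    to_UEA (p + q) = to_UEA p \<oplus>\<^bsub>UEA\<^esub> to_UEA q"
  using ring_hom_add[OF to_UEA_hom, of p q] by (simp add: ncpoly_algebra_def)

lemma to_UEA_mult:
  "p \<in> carrier (ncpoly_algebra n) \<Longrightarrow> q \<in> carrier (ncpoly_algebra n) \<Longrightarrow>
    to_UEA (p * q) = to_UEA p \<otimes>\<^bsub>UEA\<^esub> to_UEA q"
  using ring_hom_mult[OF to_UEA_hom, of p q] by (simp add: ncpoly_algebra_def)

lemma ring_UEA: "ring UEA"
proof -
  interpret Q: ring "ncpoly_algebra n Quot relation_ideal"
    using ideal_relation_ideal by (rule ideal.quotient_is_ring)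
  show ?thesis
  proof (rule ringI)
    show "abelian_group UEA"
    proof (rule abelian_groupI, goal_cases)
      case (4 x y)
      then show ?case unfolding UEA_sel by (rule Q.a_comm)
    next
      case (6 x)
      then show ?case unfolding UEA_sel using Q.l_neg Q.a_inv_closed by blast
    qed (simp_all add: UEA_sel Q.a_assoc)
    show "monoid UEA"
      by (rule monoidI) (simp_all add: UEA_sel Q.m_assoc)
  qed (simp_all add: UEA_sel Q.l_distr Q.r_distr)
qed

lemma to_UEA_smult:
  assumes p: "p \<in> carrier (ncpoly_algebra n)"
  shows "to_UEA (ncpoly_smult c p) = c \<odot>\<^bsub>UEA\<^esub> to_UEA p"
proof -
  let ?A = "ncpoly_algebra n :: ('k, 'k ncpoly) module"
  interpret I: ideal relation_ideal ?A by (rule ideal_relation_ideal)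
  have smult_closed: "ncpoly_smult c q \<in> carrier ?A" if "q \<in> carrier ?A" for q
    using that by (auto simp: carrier_ncpoly_algebra in_keys_iff)
  have same: "to_UEA (ncpoly_smult c q) = to_UEA (ncpoly_smult c p)" if q_in: "q \<in> to_UEA p" for q
  proof -
    have q: "q \<in> carrier ?A"
      using q_in p I.a_r_coset_subset_G[of relation_ideal p] I.a_subset by (auto simp: to_UEA_def)
    obtain r where r: "r \<in> relation_ideal" "q = r + p"
      using q_in by (auto simp: to_UEA_def a_r_coset_def' ncpoly_algebra_def)
    have "Poly_Mapping.single [] c \<in> carrier ?A"
      by (simp add: carrier_ncpoly_algebra)
    then have "ncpoly_smult c r \<in> relation_ideal"
      using I.I_l_closed[OF r(1)] by (auto simp: ncpoly_algebra_def ncpoly_smult_conv_mult)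
    moreover have "ncpoly_smult c q = ncpoly_smult c r \<oplus>\<^bsub>?A\<^esub> ncpoly_smult c p"
      by (simp add: r ncpoly_algebra_def ncpoly_smult_conv_mult distrib_left)
    ultimately have "ncpoly_smult c q \<in> to_UEA (ncpoly_smult c p)"
      by (auto simp: to_UEA_def a_r_coset_def')
    then show ?thesis
      unfolding to_UEA_def by (rule I.a_repr_independence'[OF _ smult_closed[OF p], symmetric])
  qed
  have "p \<in> to_UEA p"
    unfolding to_UEA_def by (rule I.a_rcos_self[OF p])
  moreover have "c \<odot>\<^bsub>UEA\<^esub> to_UEA p = (\<Union>q\<in>to_UEA p. to_UEA (ncpoly_smult c q))"
    by (simp add: UEA_def Let_def to_UEA_def ncpoly_algebra_def)
  moreover have "\<dots> = (\<Union>q\<in>to_UEA p. to_UEA (ncpoly_smult c p))"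
    by (rule SUP_cong[OF refl same])
  ultimately show ?thesis by auto
qed

lemma vectorspace_UEA: "vectorspace class_ring UEA"
proof -
  let ?A = "ncpoly_algebra n :: ('k, 'k ncpoly) module"
  interpret U: ring UEA by (rule ring_UEA)
  have smult_closed: "ncpoly_smult c q \<in> carrier ?A" if "q \<in> carrier ?A" for c q
    using that by (auto simp: carrier_ncpoly_algebra in_keys_iff)
  have add_closed: "p + q \<in> carrier ?A" if "p \<in> carrier ?A" "q \<in> carrier ?A" for p q
    using that keys_add[of p q] by (auto simp: carrier_ncpoly_algebra)
  have "module class_ring UEA"
  proof (rule moduleI)
    show "cring (class_ring :: 'k ring)" by (rule class_cring.is_cring)
    show "abelian_group UEA" by (rule U.is_abelian_group)
  next
    fix c d :: 'k and u v
    assume "u \<in> carrier UEA" "v \<in> carrier UEA"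
    then obtain p q where p: "p \<in> carrier ?A" "u = to_UEA p" and q: "q \<in> carrier ?A" "v = to_UEA q"
      by (auto simp: carrier_UEA)
    note [simp] = p q smult_closed add_closed to_UEA_smult[symmetric] to_UEA_add[symmetric]
    show "c \<odot>\<^bsub>UEA\<^esub> u \<in> carrier UEA" by (simp add: carrier_UEA)
    show "(c \<oplus>\<^bsub>class_ring\<^esub> d) \<odot>\<^bsub>UEA\<^esub> u = c \<odot>\<^bsub>UEA\<^esub> u \<oplus>\<^bsub>UEA\<^esub> d \<odot>\<^bsub>UEA\<^esub> u"
      by (simp add: ncpoly_smult_simps)
    show "c \<odot>\<^bsub>UEA\<^esub> (u \<oplus>\<^bsub>UEA\<^esub> v) = c \<odot>\<^bsub>UEA\<^esub> u \<oplus>\<^bsub>UEA\<^esub> c \<odot>\<^bsub>UEA\<^esub> v"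
      by (simp add: ncpoly_smult_simps)
    show "(c \<otimes>\<^bsub>class_ring\<^esub> d) \<odot>\<^bsub>UEA\<^esub> u = c \<odot>\<^bsub>UEA\<^esub> (d \<odot>\<^bsub>UEA\<^esub> u)"
      by (simp add: ncpoly_smult_simps)
    show "\<one>\<^bsub>class_ring\<^esub> \<odot>\<^bsub>UEA\<^esub> u = u"
      by (simp add: ncpoly_smult_simps)
  qed
  then show ?thesis by (rule vectorspace.intro) (rule class_field.field_axioms)
qed

end

text \<open>A family is a basis if its members are pairwise distinct and form a basis as a set.\<close>

definition basis_family ::
  "('k, 'm) ring_scheme \<Rightarrow> ('k, 'v, 'n) module_scheme \<Rightarrow> 'i set \<Rightarrow> ('i \<Rightarrow> 'v) \<Rightarrow> bool" where
  "basis_family K V I b \<longleftrightarrow> inj_on b I \<and> vectorspace.basis K V (b ` I)"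

end

theory Submission
  imports Defs
begin

text \<open>This is the Poincare--Birkhoff--Witt theorem together with the triangularity argument that
  passes from the ordered monomials to other families.

  The easy half is that the ordered monomials span: modulo the relation ideal, a descent in a word,
  that is a factor \<open>X j X i\<close> with \<open>i < j\<close>, may be replaced by \<open>X i X j\<close> plus the shorter
  \<open>[X j, X i]\<close>. Rewriting descents until none is left terminates, because it decreases words in the
  degree-lexicographic order. The hard half is that no nontrivial relation between ordered monomials
  is introduced. It suffices that the outcome \<open>normal_form\<close> of the rewriting, extended linearly,
  vanishes on the relators. Since it fixes ordered monomials, it then separates them modulo the ideal.
  That it vanishes amounts to the rewriting rule being satisfied at every descent, not only at
  the one that the recursion picks (\<open>normal_form_commutes_up_to_bracket\<close>). By induction along the
  order, this is the comparison of the first steps at two descents of one word, as in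
  Bergman's diamond lemma. Disjoint descents can be rewritten one after the other in either order.
  Overlapping descents \<open>X x X y X z\<close> with \<open>x > y > z\<close> are the only place where the Jacobi identity is
  needed: up to sign, the two ways of reversing them differ by its left-hand side.

  For the families of the theorem, observe that rewriting changes a word only by sorting it and
  by adding shorter words (\<open>normal_form_leading_word\<close>). Hence the normal form of any monomial equipollent
  to \<open>X\<^sup>\<alpha>\<close>, and of an average of such monomials, is \<open>X\<^sup>\<alpha>\<close> plus terms of smaller degree. A family
  of polynomials with this property is unitriangular with respect to the ordered monomials, and so
  is a basis of the quotient (\<open>basis_family_if_leading_word\<close>). Characteristic zero serves to
  average over the symmetric group.\<close>


section \<open>Linear maps on non-commutative polynomials\<close>

interpretation ncpoly: vector_space ncpoly_smult
  by standard (simp_all add: ncpoly_smult_simps)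

lemma ncpoly_linearI:
  assumes "\<And>p q. f (p + q) = f p + f q" "\<And>c p. f (ncpoly_smult c p) = ncpoly_smult c (f p)"
  shows "Vector_Spaces.linear ncpoly_smult ncpoly_smult f"
  using assms by (simp add: Vector_Spaces.linear_iff ncpoly.vector_space_axioms)

lemma sum_monomials: "(\<Sum>w\<in>Poly_Mapping.keys p. ncpoly_smult (Poly_Mapping.lookup p w) (monomial w)) = p"
  by (intro poly_mapping_eqI)
    (simp add: lookup_sum monomial_def lookup_single when_def in_keys_iff if_distrib[of "(*) _"] cong: if_cong)

lemma linear_mult_both: "Vector_Spaces.linear ncpoly_smult ncpoly_smult (\<lambda>p. P * p * Q)"
proof (rule ncpoly_linearI)
  show "P * ncpoly_smult c p * Q = ncpoly_smult c (P * p * Q)" for c p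
    unfolding mult_ncpoly_smult by (simp add: ncpoly_smult_conv_mult mult.assoc)
qed (simp add: algebra_simps)

definition linear_extension :: "(nat list \<Rightarrow> 'k::field ncpoly) \<Rightarrow> 'k ncpoly \<Rightarrow> 'k ncpoly" where
  "linear_extension g p = (\<Sum>w\<in>Poly_Mapping.keys p. ncpoly_smult (Poly_Mapping.lookup p w) (g w))"

lemma linear_extension_monomial [simp]: "linear_extension g (monomial w) = g w"
  by (simp add: linear_extension_def monomial_def)

lemma linear_linear_extension: "Vector_Spaces.linear ncpoly_smult ncpoly_smult (linear_extension g)"
proof (rule ncpoly_linearI)
  show "linear_extension g (p + q) = linear_extension g p + linear_extension g q" for p q
    unfolding linear_extension_def by (rule setsum_keys_plus_distrib) (simp_all add: ncpoly_smult_simps)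
  show "linear_extension g (ncpoly_smult c p) = ncpoly_smult c (linear_extension g p)" for c p
  proof -
    have "linear_extension g (ncpoly_smult c p) =
      (\<Sum>w\<in>Poly_Mapping.keys p. ncpoly_smult (Poly_Mapping.lookup (ncpoly_smult c p) w) (g w))"
      unfolding linear_extension_def
      by (rule sum.mono_neutral_left) (auto simp: in_keys_iff)
    then show ?thesis by (simp add: linear_extension_def ncpoly.scale_sum_right)
  qed
qed

lemma ncpoly_linear_vanishes:
  assumes f: "Vector_Spaces.linear ncpoly_smult ncpoly_smult f" "\<And>w. f (monomial w) = 0"
  shows "f p = 0"
proof -
  interpret f: Vector_Spaces.linear ncpoly_smult ncpoly_smult f by (rule f(1))
  have "f p = f (\<Sum>w\<in>Poly_Mapping.keys p. ncpoly_smult (Poly_Mapping.lookup p w) (monomial w))"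
    by (simp only: sum_monomials)
  also have "\<dots> = 0" by (simp only: f.sum f.scale f(2) ncpoly.scale_zero_right sum.neutral_const)
  finally show ?thesis .
qed

lemma subspace_keys_subset: "ncpoly.subspace {p. Poly_Mapping.keys p \<subseteq> S}"
proof (rule ncpoly.subspaceI)
  show "p + q \<in> {p. Poly_Mapping.keys p \<subseteq> S}"
    if "p \<in> {p. Poly_Mapping.keys p \<subseteq> S}" "q \<in> {p. Poly_Mapping.keys p \<subseteq> S}"
    for p q :: "'a ncpoly"
    using that keys_add[of p q] by auto
qed (auto simp: in_keys_iff)

lemma keys_monomial [simp]: "Poly_Mapping.keys (monomial w :: 'k::field ncpoly) = {w}"
  by (simp add: monomial_def)

lemma subspace_carrier: "ncpoly.subspace (carrier (ncpoly_algebra n))"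
  using subspace_keys_subset[of "lists {1..n}"] by (simp add: ncpoly_algebra_def)

lemma monomial_in_carrier: "w \<in> lists {1..n} \<Longrightarrow> monomial w \<in> carrier (ncpoly_algebra n)"
  by (simp add: carrier_ncpoly_algebra)

lemma submodule_ncpoly_algebra_iff:
  "submodule class_ring M (ncpoly_algebra n) \<longleftrightarrow>
    M \<subseteq> carrier (ncpoly_algebra n) \<and> ncpoly.subspace M"
  using vectorspace.axioms(1)[OF vectorspace_ncpoly_algebra]
  by (auto simp: submodule_def ncpoly.subspace_def carrier_ncpoly_algebra
      ncpoly_algebra_def[THEN arg_cong[of _ _ add]] ncpoly_algebra_def[THEN arg_cong[of _ _ zero]]
      ncpoly_algebra_def[THEN arg_cong[of _ _ smult]])

lemma smult_mult: "ncpoly_smult c p * q = ncpoly_smult c (p * q)"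
  by (simp add: ncpoly_smult_conv_mult mult.assoc)


section \<open>Descents and the degree-lexicographic order\<close>

text \<open>On the well-founded order \<open>lenlex less_than\<close>, both kinds of words produced by rewriting a descent
  lie below the word itself.\<close>

lemma swap_descent_lenlex: "i < j \<Longrightarrow> (u @ i # j # v, u @ j # i # v) \<in> lenlex less_than"
  by (simp add: lenlex_append2 irrefl_less_than Cons_lenlex_iff)

lemma shorter_lenlex: "length u < length v \<Longrightarrow> (u, v) \<in> lenlex r"
  by (simp add: lenlex_length lenlex_conv)

text \<open>Any choice of a descent would do: confluence shows that the normal form does not depend on it.\<close>

definition some_descent :: "nat list \<Rightarrow> nat list \<times> nat \<times> nat \<times> nat list" where
  "some_descent w = (SOME (u, j, i, v). w = u @ j # i # v \<and> i < j)"

lemma unsorted_has_descent: "\<not> sorted w \<Longrightarrow> \<exists>u j i v. w = u @ j # i # v \<and> i < (j::nat)"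
proof (induction w rule: induct_list012)
  case (3 x y w)
  show ?case
  proof (cases "y < x")
    case True
    then show ?thesis by (metis append_Nil)
  next
    case False
    then have "\<not> sorted (y # w)" using 3(3) by (metis sorted2 linorder_not_less)
    then show ?thesis using 3 by (metis append_Cons)
  qed
qed auto

lemma some_descent:
  assumes "\<not> sorted w" "some_descent w = (u, j, i, v)"
  shows "w = u @ j # i # v" "i < j"
proof -
  have "\<exists>d. case d of (u, j, i, v) \<Rightarrow> w = u @ j # i # v \<and> i < j"
    using unsorted_has_descent[OF assms(1)] by auto
  from someI_ex[OF this] assms(2) show "w = u @ j # i # v" "i < j"
    unfolding some_descent_def by auto
qed


section \<open>Normal forms of words\<close>

context lie_algebra_basis
begin

interpretation L: vector_space_pair scale ncpoly_smult ..

definition coord :: "'l \<Rightarrow> nat \<Rightarrow> 'k" where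
  "coord x k = representation (X ` {1..n}) x (X k)"

lemma coord_add: "coord (x + y) k = coord x k + coord y k"
  using representation_add[OF independent_X, of y x] unfolding coord_def span_X by simp

lemma coord_scale: "coord (scale c x) k = c * coord x k"
  using representation_scale[OF independent_X, of x c] unfolding coord_def span_X by simp

lemma sum_coord: "(\<Sum>k\<in>{1..n}. scale (coord x k) (X k)) = x"
proof -
  have "(\<Sum>k\<in>{1..n}. scale (coord x k) (X k)) = (\<Sum>b\<in>X ` {1..n}. scale (representation (X ` {1..n}) x b) b)"
    unfolding coord_def sum.reindex[OF inj_X] by simp
  also have "\<dots> = x"
    using independent_X by (rule sum_representation_eq)
      (simp_all only: span_X finite_imageI finite_atLeastAtMost UNIV_I order_refl)
  finally show ?thesis .
qed

lemma bracket_skew: "bracket y x = - bracket x y"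
proof -
  have "bracket (x + y) (x + y) = bracket x y + bracket y x"
    by (simp only: bracket_add_left bracket_add_right) (simp add: bracket_self)
  then show ?thesis by (simp add: bracket_self eq_neg_iff_add_eq_0 add.commute)
qed

lemma bracket_minus_right: "bracket x (- y) = - bracket x y"
  using bracket_scale_right[of x "- 1" y] by simp

text \<open>Sorted words are irreducible. At a descent \<open>j, i\<close> the rule
  \<open>X j X i = X i X j + [X j, X i]\<close> is applied, with the bracket expanded in the basis.\<close>

function normal_form :: "nat list \<Rightarrow> 'k ncpoly" where
  "normal_form w = (if sorted w then monomial w else case some_descent w of (u, j, i, v) \<Rightarrow>
     normal_form (u @ i # j # v)
       + (\<Sum>k\<in>{1..n}. ncpoly_smult (coord (bracket (X j) (X i)) k) (normal_form (u @ k # v))))"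
  by auto
termination
proof (relation "lenlex less_than", goal_cases)
  case 1
  show ?case by (simp add: wf_lenlex)
next
  case (2 w u p j q i v)
  then have "some_descent w = (u, j, i, v)" by simp
  from some_descent[OF 2(1) this] show ?case by (simp only: swap_descent_lenlex)
next
  case (3 w u p j q i v k)
  then have "some_descent w = (u, j, i, v)" by simp
  from some_descent(1)[OF 3(1) this] show ?case by (intro shorter_lenlex) simp
qed

declare normal_form.simps [simp del]

lemma normal_form_sorted: "sorted w \<Longrightarrow> normal_form w = monomial w"
  by (simp add: normal_form.simps)

text \<open>The linear extension of \<^term>\<open>\<lambda>k. normal_form (u @ k # v)\<close> from basis vectors to all Lie elements:
  the normal form of the product of \<open>u\<close>, \<open>x\<close> and \<open>v\<close>.\<close>

definition normal_form_at :: "nat list \<Rightarrow> 'l \<Rightarrow> nat list \<Rightarrow> 'k ncpoly" where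
  "normal_form_at u x v = (\<Sum>k\<in>{1..n}. ncpoly_smult (coord x k) (normal_form (u @ k # v)))"

lemma normal_form_unsorted:
  assumes "\<not> sorted w" "some_descent w = (u, j, i, v)"
  shows "normal_form w = normal_form (u @ i # j # v) + normal_form_at u (bracket (X j) (X i)) v"
  using assms by (subst normal_form.simps) (simp add: normal_form_at_def)

lemma linear_normal_form_at: "Vector_Spaces.linear scale ncpoly_smult (\<lambda>x. normal_form_at u x v)"
  unfolding Vector_Spaces.linear_iff
  using vector_space_axioms ncpoly.vector_space_axioms
  by (auto simp: normal_form_at_def coord_add coord_scale ncpoly.scale_left_distrib sum.distrib
      ncpoly.scale_sum_right)

lemmas normal_form_at_add = L.linear_add[OF linear_normal_form_at]
lemmas normal_form_at_minus = L.linear_neg[OF linear_normal_form_at]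


section \<open>Confluence\<close>

text \<open>The rewriting rule as an equation between normal forms. By definition of \<^const>\<open>normal_form\<close> it holds
  for \<open>i < j\<close> at the chosen descent. The aim is to prove it for all letters at all positions.\<close>

definition commutes_up_to_bracket :: "nat list \<Rightarrow> nat \<Rightarrow> nat \<Rightarrow> nat list \<Rightarrow> bool" where
  "commutes_up_to_bracket u j i v \<longleftrightarrow>
    normal_form (u @ j # i # v) = normal_form (u @ i # j # v) + normal_form_at u (bracket (X j) (X i)) v"

lemma commutes_up_to_bracket_commute:
  "commutes_up_to_bracket u j i v \<longleftrightarrow> commutes_up_to_bracket u i j v"
  unfolding commutes_up_to_bracket_def bracket_skew[of "X j" "X i"] normal_form_at_minus
    add_uminus_conv_diff eq_diff_eq by (rule eq_commute)

lemma commutes_up_to_bracket_same: "commutes_up_to_bracket u i i v"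
  by (simp add: commutes_up_to_bracket_def bracket_self L.linear_0[OF linear_normal_form_at])

text \<open>The rule for two letters extends bilinearly to a Lie element \<open>x\<close> followed by a letter. This is how
  shorter words, in which a bracket has already been formed, are handled.\<close>

lemma normal_form_at_move_right:
  assumes "\<And>k. commutes_up_to_bracket u k z v"
  shows "normal_form_at u x (z # v) = normal_form_at (u @ [z]) x v + normal_form_at u (bracket x (X z)) v"
proof -
  have br: "bracket x (X z) = (\<Sum>k\<in>{1..n}. scale (coord x k) (bracket (X k) (X z)))"
  proof -
    have "Vector_Spaces.linear scale scale (\<lambda>x. bracket x (X z))"
      by (simp add: Vector_Spaces.linear_iff vector_space_axioms bracket_add_left bracket_scale_left)
    then interpret br: Vector_Spaces.linear scale scale "\<lambda>x. bracket x (X z)" .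
    have "bracket x (X z) = bracket (\<Sum>k\<in>{1..n}. scale (coord x k) (X k)) (X z)"
      by (simp only: sum_coord)
    then show ?thesis by (simp only: br.sum br.scale)
  qed
  have "normal_form_at u x (z # v) =
    (\<Sum>k\<in>{1..n}. ncpoly_smult (coord x k)
      (normal_form (u @ z # k # v) + normal_form_at u (bracket (X k) (X z)) v))"
    unfolding normal_form_at_def[of u x "z # v"]
    using assms by (simp add: commutes_up_to_bracket_def)
  also have "\<dots> = normal_form_at (u @ [z]) x v + normal_form_at u (bracket x (X z)) v"
    unfolding br L.linear_sum[OF linear_normal_form_at] L.linear_scale[OF linear_normal_form_at]
    by (simp add: ncpoly.scale_right_distrib sum.distrib normal_form_at_def[of "u @ [z]"])
  finally show ?thesis .
qed

text \<open>What rewriting at a given descent leads to; confluence is that all descents of a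
  word give the same value.\<close>

abbreviation one_step_at :: "nat list \<Rightarrow> nat \<Rightarrow> nat \<Rightarrow> nat list \<Rightarrow> 'k ncpoly" where
  "one_step_at u j i v \<equiv> normal_form (u @ i # j # v) + normal_form_at u (bracket (X j) (X i)) v"

text \<open>After rewriting at one descent the other is still present. The word with both descents swapped and the
  three terms with brackets in one or both places are obtained in either order.\<close>

lemma disjoint_descents_confluent:
  assumes w: "w = u @ j # i # c @ j' # i' # v" and "i < j" "i' < j'"
    and IH: "\<And>a p q b. (a @ p # q # b, w) \<in> lenlex less_than \<Longrightarrow> q < p \<Longrightarrow> commutes_up_to_bracket a p q b"
    and short: "\<And>a p q b. length (a @ p # q # b) < length w \<Longrightarrow> commutes_up_to_bracket a p q b"
  shows "one_step_at u j i (c @ j' # i' # v) = one_step_at (u @ j # i # c) j' i' v"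
proof -
  let ?x = "bracket (X j) (X i)" and ?y = "bracket (X j') (X i')"
  have "normal_form_at u ?x (c @ j' # i' # v) =
    (\<Sum>k\<in>{1..n}. ncpoly_smult (coord ?x k)
      (normal_form (u @ k # c @ i' # j' # v) + normal_form_at (u @ k # c) ?y v))"
  proof -
    have "normal_form (u @ k # c @ j' # i' # v) =
      normal_form (u @ k # c @ i' # j' # v) + normal_form_at (u @ k # c) ?y v" for k
      using short[of "u @ k # c" j' i' v] by (simp add: w commutes_up_to_bracket_def)
    then show ?thesis by (simp add: normal_form_at_def[of u])
  qed
  also have "\<dots> = normal_form_at u ?x (c @ i' # j' # v) +
    (\<Sum>k\<in>{1..n}. ncpoly_smult (coord ?x k) (normal_form_at (u @ k # c) ?y v))"
    by (simp add: normal_form_at_def[of u] ncpoly.scale_right_distrib sum.distrib)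
  finally have 1: "normal_form_at u ?x (c @ j' # i' # v) = \<dots>" .
  have "normal_form_at (u @ j # i # c) ?y v =
    (\<Sum>l\<in>{1..n}. ncpoly_smult (coord ?y l)
      (normal_form (u @ i # j # c @ l # v) + normal_form_at u ?x (c @ l # v)))"
  proof -
    have "normal_form (u @ j # i # c @ l # v) =
      normal_form (u @ i # j # c @ l # v) + normal_form_at u ?x (c @ l # v)" for l
      using short[of u j i "c @ l # v"] by (simp add: w commutes_up_to_bracket_def)
    then show ?thesis by (simp add: normal_form_at_def[of "u @ j # i # c"])
  qed
  also have "\<dots> = normal_form_at (u @ i # j # c) ?y v +
    (\<Sum>l\<in>{1..n}. ncpoly_smult (coord ?y l) (normal_form_at u ?x (c @ l # v)))"
    by (simp add: normal_form_at_def[of "u @ i # j # c"] ncpoly.scale_right_distrib sum.distrib)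
  finally have 2: "normal_form_at (u @ j # i # c) ?y v = \<dots>" .
  have 3: "(\<Sum>k\<in>{1..n}. ncpoly_smult (coord ?x k) (normal_form_at (u @ k # c) ?y v)) =
    (\<Sum>l\<in>{1..n}. ncpoly_smult (coord ?y l) (normal_form_at u ?x (c @ l # v)))"
    unfolding normal_form_at_def ncpoly.scale_sum_right
    by (subst sum.swap) (simp add: mult.commute)
  have "(u @ i # j # c @ j' # i' # v, w) \<in> lenlex less_than"
    using swap_descent_lenlex[OF \<open>i < j\<close>] w by simp
  then have 4: "normal_form (u @ i # j # c @ j' # i' # v) =
      normal_form (u @ i # j # c @ i' # j' # v) + normal_form_at (u @ i # j # c) ?y v"
    using IH[of "u @ i # j # c" j' i' v] \<open>i' < j'\<close> by (simp add: commutes_up_to_bracket_def)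
  have "(u @ j # i # c @ i' # j' # v, w) \<in> lenlex less_than"
    using swap_descent_lenlex[OF \<open>i' < j'\<close>, of "u @ j # i # c"] w by simp
  then have 5: "normal_form (u @ j # i # c @ i' # j' # v) =
      normal_form (u @ i # j # c @ i' # j' # v) + normal_form_at u ?x (c @ i' # j' # v)"
    using IH[of u j i "c @ i' # j' # v"] \<open>i < j\<close> by (simp add: commutes_up_to_bracket_def)
  show ?thesis
    unfolding 1 2 3 using 4 5 by (simp add: algebra_simps)
qed

text \<open>Both sides reduce to the reversed word \<open>z, y, x\<close>, and each leaves three brackets of two letters next to
  the third one. Moving these brackets past the letter to a common position costs double brackets,
  and the double brackets cancel by the Jacobi identity.\<close>

lemma overlapping_descents_confluent:
  assumes w: "w = u @ x # y # z # v" and "z < y" "y < x"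
    and IH: "\<And>a p q b. (a @ p # q # b, w) \<in> lenlex less_than \<Longrightarrow> q < p \<Longrightarrow> commutes_up_to_bracket a p q b"
    and short: "\<And>a p q b. length (a @ p # q # b) < length w \<Longrightarrow> commutes_up_to_bracket a p q b"
  shows "one_step_at u x y (z # v) = one_step_at (u @ [x]) y z v"
proof -
  have less: "(u @ y # x # z # v, w) \<in> lenlex less_than" "(u @ y # z # x # v, w) \<in> lenlex less_than"
    "(u @ x # z # y # v, w) \<in> lenlex less_than" "(u @ z # x # y # v, w) \<in> lenlex less_than"
    using \<open>z < y\<close> \<open>y < x\<close> by (simp_all add: w lenlex_append2 irrefl_less_than Cons_lenlex_iff)
  \<comment> \<open>The left-hand side takes the path \<open>xyz, yxz, yzx, zyx\<close>.\<close>
  have 1: "normal_form (u @ y # x # z # v) =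
      normal_form (u @ y # z # x # v) + normal_form_at (u @ [y]) (bracket (X x) (X z)) v"
    using IH[of "u @ [y]" x z v] less(1) \<open>z < y\<close> \<open>y < x\<close> by (simp add: commutes_up_to_bracket_def)
  have 2: "normal_form (u @ y # z # x # v) =
      normal_form (u @ z # y # x # v) + normal_form_at u (bracket (X y) (X z)) (x # v)"
    using IH[of u y z "x # v"] less(2) \<open>z < y\<close> by (simp add: commutes_up_to_bracket_def)
  \<comment> \<open>The right-hand side takes the path \<open>xyz, xzy, zxy, zyx\<close>.\<close>
  have 3: "normal_form (u @ x # z # y # v) =
      normal_form (u @ z # x # y # v) + normal_form_at u (bracket (X x) (X z)) (y # v)"
    using IH[of u x z "y # v"] less(3) \<open>z < y\<close> \<open>y < x\<close> by (simp add: commutes_up_to_bracket_def)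
  have 4: "normal_form (u @ z # x # y # v) =
      normal_form (u @ z # y # x # v) + normal_form_at (u @ [z]) (bracket (X x) (X y)) v"
    using IH[of "u @ [z]" x y v] less(4) \<open>y < x\<close> by (simp add: commutes_up_to_bracket_def)
  have move: "normal_form_at u l (t # v) = normal_form_at (u @ [t]) l v + normal_form_at u (bracket l (X t)) v" for l t
    by (rule normal_form_at_move_right) (simp add: short w)
  have jac: "normal_form_at u (bracket (bracket (X x) (X y)) (X z)) v
      + normal_form_at u (bracket (bracket (X y) (X z)) (X x)) v
      = normal_form_at u (bracket (bracket (X x) (X z)) (X y)) v"
  proof -
    have "bracket (bracket (X x) (X y)) (X z) + bracket (bracket (X y) (X z)) (X x)
        = bracket (bracket (X x) (X z)) (X y)"
    proof -
      have "bracket (X y) (bracket (X z) (X x)) = bracket (bracket (X x) (X z)) (X y)"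
        using bracket_skew[of "X z" "X x"] bracket_skew[of "X y" "bracket (X x) (X z)"]
        by (simp add: bracket_minus_right)
      then show ?thesis
        using jacobi[of "X x" "X y" "X z"] bracket_skew[of "X z" "bracket (X x) (X y)"]
          bracket_skew[of "X x" "bracket (X y) (X z)"]
        by (simp add: algebra_simps)
    qed
    then show ?thesis by (simp only: normal_form_at_add[symmetric])
  qed
  then show ?thesis
    by (simp add: 1 2 3 4 move algebra_simps)
qed

text \<open>Along the well-founded order, all smaller words obey the rule, so that any two descents of the
  current word give the same value. One of them is the descent used in the definition of the normal
  form. Letters in ascending order are covered by skew-symmetry, equal ones by \<open>[x, x] = 0\<close>.\<close>

theorem normal_form_commutes_up_to_bracket: "commutes_up_to_bracket u j i v"
proof -
  have descending: "\<forall>u j i v. w = u @ j # i # v \<longrightarrow> i < j \<longrightarrow> commutes_up_to_bracket u j i v" for w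
  proof (induction w rule: wf_induct_rule[OF wf_lenlex[OF wf_less_than]])
    case (1 w)
    have IH: "commutes_up_to_bracket a p q b"
      if "(a @ p # q # b, w) \<in> lenlex less_than" "q < p" for a p q b
      using 1[OF that(1)] that(2) by blast
    have short: "commutes_up_to_bracket a p q b" if "length (a @ p # q # b) < length w" for a p q b
    proof (cases p q rule: linorder_cases)
      case less
      then show ?thesis using IH[of a q p b] that commutes_up_to_bracket_commute[of a p q b] by (simp add: shorter_lenlex)
    next
      case greater
      then show ?thesis using IH[of a p q b] that by (simp add: shorter_lenlex)
    qed (simp add: commutes_up_to_bracket_same)
    \<comment> \<open>Two descents are equal, overlap in one letter, or are disjoint, by the position of the second.\<close>
    have later: "one_step_at u j i v = one_step_at u' j' i' v'"
      if d: "w = u @ j # i # v" "i < j" "w = u' @ j' # i' # v'" "i' < j'" and le: "length u \<le> length u'"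
      for u j i v u' j' i' v'
    proof -
      obtain c where c: "u' = u @ c" "j # i # v = c @ j' # i' # v'"
        using d(1,3) le by (auto simp: append_eq_append_conv2)
      consider "c = []" | "c = [j]" | c' where "c = j # i # c'"
        using c(2) by (cases c; cases "tl c") auto
      then show ?thesis
      proof cases
        case 1
        then show ?thesis using c by simp
      next
        case 2
        then show ?thesis
          using overlapping_descents_confluent[of w u j i i' v'] c d IH short by simp
      next
        case (3 c')
        then show ?thesis
          using disjoint_descents_confluent[of w u j i c' j' i' v'] c d IH short by simp
      qed
    qed
    show ?case
    proof (intro allI impI)
      fix u j i v assume d: "w = u @ j # i # v" "i < j"
      then have ns: "\<not> sorted w" by (auto simp: sorted_append)
      obtain u' j' i' v' where sd: "some_descent w = (u', j', i', v')" by (metis prod_cases4)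
      have "normal_form w = one_step_at u' j' i' v'" by (rule normal_form_unsorted[OF ns sd])
      also have "\<dots> = one_step_at u j i v"
        using later[of u' j' i' v' u j i v] later[of u j i v u' j' i' v'] d some_descent[OF ns sd]
        by (metis nle_le)
      finally show "commutes_up_to_bracket u j i v" by (simp add: commutes_up_to_bracket_def d(1))
    qed
  qed
  show ?thesis
    using descending commutes_up_to_bracket_commute commutes_up_to_bracket_same
    by (metis linorder_neqE_nat)
qed


section \<open>The relation ideal\<close>

definition relator :: "'l \<Rightarrow> 'l \<Rightarrow> 'k ncpoly" where
  "relator x y = lie_embed x * lie_embed y - lie_embed y * lie_embed x - lie_embed (bracket x y)"

lemma lie_embed_coord: "lie_embed x = (\<Sum>i\<in>{1..n}. ncpoly_smult (coord x i) (monomial [i]))"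
  by (simp add: lie_embed_def coord_def)

lemma lie_embed_add: "lie_embed (x + y) = lie_embed x + lie_embed y"
  by (simp add: lie_embed_coord coord_add ncpoly.scale_left_distrib sum.distrib)

lemma lie_embed_scale: "lie_embed (scale c x) = ncpoly_smult c (lie_embed x)"
  by (simp add: lie_embed_coord coord_scale ncpoly.scale_sum_right)

lemma linear_relator_left: "Vector_Spaces.linear scale ncpoly_smult (\<lambda>x. relator x y)"
  by (simp add: Vector_Spaces.linear_iff vector_space_axioms ncpoly.vector_space_axioms relator_def
      bracket_add_left bracket_scale_left lie_embed_add lie_embed_scale smult_mult mult_ncpoly_smult
      ncpoly.scale_right_diff_distrib algebra_simps)

lemma linear_relator_right: "Vector_Spaces.linear scale ncpoly_smult (relator x)"
  by (simp add: Vector_Spaces.linear_iff vector_space_axioms ncpoly.vector_space_axioms relator_def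
      bracket_add_right bracket_scale_right lie_embed_add lie_embed_scale smult_mult mult_ncpoly_smult
      ncpoly.scale_right_diff_distrib algebra_simps)

lemma lie_linear_vanishes:
  assumes f: "Vector_Spaces.linear scale ncpoly_smult f" "\<And>i. i \<in> {1..n} \<Longrightarrow> f (X i) = 0"
  shows "f x = 0"
proof -
  interpret f: Vector_Spaces.linear scale ncpoly_smult f by (rule f(1))
  have "f x = f (\<Sum>k\<in>{1..n}. scale (coord x k) (X k))"
    by (simp only: sum_coord)
  also have "\<dots> = 0" by (simp only: f.sum f.scale f(2) ncpoly.scale_zero_right sum.neutral_const cong: sum.cong)
  finally show ?thesis .
qed

text \<open>The relators of two basis vectors between words are precisely the differences of the two sides of
  the rewriting rule.\<close>

lemma monomial_relator:
  assumes "j \<in> {1..n}" "i \<in> {1..n}"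
  shows "monomial u * relator (X j) (X i) * monomial v = monomial (u @ j # i # v) - monomial (u @ i # j # v)
    - (\<Sum>k\<in>{1..n}. ncpoly_smult (coord (bracket (X j) (X i)) k) (monomial (u @ k # v)))"
proof -
  have m: "monomial u * (monomial [a] * monomial [b]) * monomial v = monomial (u @ a # b # v)"
    "monomial u * monomial [a] * monomial v = monomial (u @ a # v)" for a b
    by (simp_all add: monomial_append[symmetric])
  have "monomial u * lie_embed z * monomial v =
      (\<Sum>k\<in>{1..n}. ncpoly_smult (coord z k) (monomial (u @ k # v)))" for z
    by (simp add: lie_embed_coord sum_distrib_left sum_distrib_right mult_ncpoly_smult smult_mult m)
  then show ?thesis
    using assms by (simp add: relator_def lie_embed_X right_diff_distrib left_diff_distrib m)
qed

text \<open>The expression is linear in each of \<open>P\<close>, \<open>x\<close>, \<open>y\<close>, \<open>Q\<close>, which reduces the claim to words and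
  basis vectors. There it is the rewriting rule.\<close>

lemma normal_form_relator: "linear_extension normal_form (P * relator x y * Q) = 0"
proof -
  let ?N = "linear_extension normal_form"
  interpret N: Vector_Spaces.linear ncpoly_smult ncpoly_smult ?N by (rule linear_linear_extension)
  have words: "?N (monomial u * relator (X j) (X i) * monomial v) = 0"
    if "j \<in> {1..n}" "i \<in> {1..n}" for u v i j
    using that normal_form_commutes_up_to_bracket[of u j i v]
    by (simp add: monomial_relator N.diff N.sum N.scale commutes_up_to_bracket_def normal_form_at_def)
  have lin: "Vector_Spaces.linear ncpoly_smult ncpoly_smult (\<lambda>p. ?N (P * p * Q))" for P Q
    using Vector_Spaces.linear_compose[OF linear_mult_both linear_linear_extension] by (simp add: o_def)
  have basis: "?N (monomial u * relator (X j) y * monomial v) = 0" if "j \<in> {1..n}" for u v y j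
    using lie_linear_vanishes[OF Vector_Spaces.linear_compose[OF linear_relator_right lin]] words that
    by (simp add: o_def)
  have "?N (monomial u * relator x y * monomial v) = 0" for u v
    using lie_linear_vanishes[OF Vector_Spaces.linear_compose[OF linear_relator_left lin]] basis
    by (simp add: o_def)
  then have "?N (monomial u * relator x y * Q) = 0" for u
    using ncpoly_linear_vanishes[OF lin[of "monomial u * relator x y" 1]] by simp
  then show ?thesis
    using ncpoly_linear_vanishes[OF lin[of 1 "relator x y * Q"]] by (simp add: mult.assoc)
qed

lemma relators_eq: "relators = {P * relator x y * Q | P Q x y.
    P \<in> carrier (ncpoly_algebra n) \<and> Q \<in> carrier (ncpoly_algebra n)}"
  by (simp add: relators_def relator_def)

lemma submodule_relation_ideal: "submodule class_ring relation_ideal (ncpoly_algebra n)"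
proof -
  interpret V: vectorspace "class_ring :: 'k ring" "ncpoly_algebra n" by (rule vectorspace_ncpoly_algebra)
  show ?thesis unfolding relation_ideal_def by (rule V.span_is_submodule[OF relators_subset_carrier])
qed

lemma subspace_relation_ideal: "ncpoly.subspace relation_ideal"
  using submodule_relation_ideal by (simp add: submodule_ncpoly_algebra_iff)

lemma relators_subset_relation_ideal: "relators \<subseteq> relation_ideal"
proof -
  interpret V: vectorspace "class_ring :: 'k ring" "ncpoly_algebra n" by (rule vectorspace_ncpoly_algebra)
  show ?thesis unfolding relation_ideal_def by (rule V.in_own_span[OF relators_subset_carrier])
qed

lemma normal_form_relation_ideal:
  assumes "p \<in> relation_ideal"
  shows "linear_extension normal_form p = 0"
proof -
  interpret V: vectorspace "class_ring :: 'k ring" "ncpoly_algebra n" by (rule vectorspace_ncpoly_algebra)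
  interpret N: Vector_Spaces.linear ncpoly_smult ncpoly_smult "linear_extension normal_form"
    by (rule linear_linear_extension)
  let ?K = "carrier (ncpoly_algebra n) \<inter> {q. linear_extension normal_form q = 0}"
  have "linear_extension normal_form r = 0" if "r \<in> relators" for r
    using that normal_form_relator unfolding relators_eq by blast
  then have "relators \<subseteq> ?K"
    using relators_subset_carrier by blast
  moreover have "submodule class_ring ?K (ncpoly_algebra n)"
    unfolding submodule_ncpoly_algebra_iff
    using ncpoly.subspace_inter[OF subspace_carrier N.subspace_kernel] by blast
  ultimately have "relation_ideal \<subseteq> ?K"
    unfolding relation_ideal_def by (rule V.span_is_subset)
  then show ?thesis using assms by auto
qed

text \<open>Each rewriting step subtracts a relator; the remaining words are smaller.\<close>

lemma monomial_minus_normal_form: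
  "w \<in> lists {1..n} \<Longrightarrow> monomial w - normal_form w \<in> relation_ideal"
proof (induction w rule: wf_induct_rule[OF wf_lenlex[OF wf_less_than]])
  case (1 w)
  show ?case
  proof (cases "sorted w")
    case True
    then show ?thesis by (simp add: normal_form_sorted ncpoly.subspace_0[OF subspace_relation_ideal])
  next
    case False
    then obtain u j i v where d: "w = u @ j # i # v" "i < j" using unsorted_has_descent by blast
    let ?c = "coord (bracket (X j) (X i))"
    have letters: "u \<in> lists {1..n}" "v \<in> lists {1..n}" "i \<in> {1..n}" "j \<in> {1..n}"
      using 1(2) by (auto simp: d(1))
    have "normal_form w = normal_form (u @ i # j # v)
      + (\<Sum>k\<in>{1..n}. ncpoly_smult (?c k) (normal_form (u @ k # v)))"
      using normal_form_commutes_up_to_bracket[of u j i v]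
      by (simp add: d(1) commutes_up_to_bracket_def normal_form_at_def)
    then have "monomial w - normal_form w = monomial u * relator (X j) (X i) * monomial v
      + (monomial (u @ i # j # v) - normal_form (u @ i # j # v))
      + (\<Sum>k\<in>{1..n}. ncpoly_smult (?c k) (monomial (u @ k # v) - normal_form (u @ k # v)))"
      using letters monomial_relator[of j i u v]
      by (simp add: d(1) ncpoly.scale_right_diff_distrib sum_subtractf)
    also have "\<dots> \<in> relation_ideal"
    proof (intro ncpoly.subspace_add[OF subspace_relation_ideal] ncpoly.subspace_sum[OF subspace_relation_ideal]
        ncpoly.subspace_scale[OF subspace_relation_ideal])
      show "monomial u * relator (X j) (X i) * monomial v \<in> relation_ideal"
        using relators_subset_relation_ideal letters monomial_in_carrier unfolding relators_eq by blast
      show "monomial (u @ i # j # v) - normal_form (u @ i # j # v) \<in> relation_ideal"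
        using letters d swap_descent_lenlex by (intro 1(1)) auto
      show "monomial (u @ k # v) - normal_form (u @ k # v) \<in> relation_ideal" if "k \<in> {1..n}" for k
        using letters that by (intro 1(1)) (auto simp: d(1) shorter_lenlex)
    qed
    finally show ?thesis .
  qed
qed

text \<open>Together with the vanishing on the ideal: the ideal is the kernel of the normal form among
  the polynomials in the variables \<open>1, \<dots>, n\<close>.\<close>

lemma minus_normal_form:
  assumes "p \<in> carrier (ncpoly_algebra n)"
  shows "p - linear_extension normal_form p \<in> relation_ideal"
proof -
  have "p - linear_extension normal_form p = (\<Sum>w\<in>Poly_Mapping.keys p.
      ncpoly_smult (Poly_Mapping.lookup p w) (monomial w - normal_form w))"
    by (simp add: ncpoly.scale_right_diff_distrib sum_subtractf sum_monomials linear_extension_def)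
  also have "\<dots> \<in> relation_ideal"
    using assms
    by (intro ncpoly.subspace_sum[OF subspace_relation_ideal]
        ncpoly.subspace_scale[OF subspace_relation_ideal] monomial_minus_normal_form)
      (auto simp: carrier_ncpoly_algebra)
  finally show ?thesis .
qed


section \<open>Leading words\<close>

definition shorter_polys :: "nat \<Rightarrow> 'k ncpoly set" where
  "shorter_polys m = {p. Poly_Mapping.keys p \<subseteq> {u \<in> lists {1..n}. length u < m}}"

lemma subspace_shorter_polys: "ncpoly.subspace (shorter_polys m)"
  unfolding shorter_polys_def by (rule subspace_keys_subset)

lemma shorter_polys_mono: "l \<le> m \<Longrightarrow> shorter_polys l \<subseteq> shorter_polys m"
  by (auto simp: shorter_polys_def)

text \<open>The swap in a rewriting step preserves the sorted word, and the bracket shortens the word.\<close>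

lemma normal_form_leading_word:
  "w \<in> lists {1..n} \<Longrightarrow> normal_form w - monomial (sort w) \<in> shorter_polys (length w)"
proof (induction w rule: wf_induct_rule[OF wf_lenlex[OF wf_less_than]])
  case (1 w)
  show ?case
  proof (cases "sorted w")
    case True
    then show ?thesis by (simp add: normal_form_sorted sorted_sort_id ncpoly.subspace_0[OF subspace_shorter_polys])
  next
    case False
    then obtain u j i v where d: "w = u @ j # i # v" "i < j" using unsorted_has_descent by blast
    let ?c = "coord (bracket (X j) (X i))" and ?S = "shorter_polys (length w)"
    have letters: "u \<in> lists {1..n}" "v \<in> lists {1..n}" "i \<in> {1..n}" "j \<in> {1..n}"
      using 1(2) by (auto simp: d(1))
    have sort: "sort w = sort (u @ i # j # v)"
      by (rule properties_for_sort) (simp_all add: d(1))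
    have "normal_form w - monomial (sort w) = (normal_form (u @ i # j # v) - monomial (sort (u @ i # j # v)))
      + (\<Sum>k\<in>{1..n}. ncpoly_smult (?c k) (normal_form (u @ k # v)))"
      unfolding sort using normal_form_commutes_up_to_bracket[of u j i v]
      by (simp add: d(1) commutes_up_to_bracket_def normal_form_at_def)
    also have "\<dots> \<in> ?S"
    proof (intro ncpoly.subspace_add[OF subspace_shorter_polys] ncpoly.subspace_sum[OF subspace_shorter_polys]
        ncpoly.subspace_scale[OF subspace_shorter_polys])
      have "length w = length (u @ i # j # v)" by (simp add: d(1))
      then show "normal_form (u @ i # j # v) - monomial (sort (u @ i # j # v)) \<in> ?S"
        using letters d swap_descent_lenlex 1(1)[of "u @ i # j # v"] by simp
      show "normal_form (u @ k # v) \<in> ?S" if "k \<in> {1..n}" for k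
      proof -
        have "normal_form (u @ k # v) - monomial (sort (u @ k # v)) \<in> shorter_polys (length (u @ k # v))"
          using letters that by (intro 1(1)) (auto simp: d(1) shorter_lenlex)
        then have "normal_form (u @ k # v) - monomial (sort (u @ k # v)) \<in> ?S"
          using shorter_polys_mono[of "length (u @ k # v)" "length w"] by (auto simp: d(1))
        moreover have "monomial (sort (u @ k # v)) \<in> ?S"
        proof -
          have "u @ k # v \<in> lists {1..n}" using letters that by simp
          then have "sort (u @ k # v) \<in> lists {1..n}" by (simp only: lists_eq_set mem_Collect_eq set_sort)
          moreover have "length (sort (u @ k # v)) < length w" by (simp add: d(1))
          ultimately show ?thesis unfolding shorter_polys_def mem_Collect_eq keys_monomial by blast
        qed
        ultimately show ?thesis
          using ncpoly.subspace_add[OF subspace_shorter_polys] by fastforce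
      qed
    qed
    finally show ?thesis .
  qed
qed

end


section \<open>Ordered words and symmetrization\<close>

lemma sorted_ordered_word: "sorted (ordered_word n \<alpha>)"
  by (induction n) (auto simp: ordered_word_def sorted_append)

lemma count_ordered_word:
  "count (mset (ordered_word n \<alpha>)) i = (if i \<in> {1..n} then \<alpha> i else 0)"
  by (induction n) (auto simp: ordered_word_def)

lemma ordered_word_in_lists: "ordered_word n \<alpha> \<in> lists {1..n}"
  by (auto simp: ordered_word_def)

lemma inj_on_ordered_word: "inj_on (ordered_word n) (multi_indices n)"
proof (rule inj_onI)
  fix \<alpha> \<beta> assume *: "\<alpha> \<in> multi_indices n" "\<beta> \<in> multi_indices n" "ordered_word n \<alpha> = ordered_word n \<beta>"
  have "\<alpha> i = \<beta> i" if "i \<in> {1..n}" for i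
    using that count_ordered_word[of n \<alpha> i] count_ordered_word[of n \<beta> i] *(3) by simp
  then show "\<alpha> = \<beta>" using *(1,2) unfolding multi_indices_def by (intro PiE_ext)
qed

text \<open>The multi-index consists of the multiplicities of the letters.\<close>

lemma sort_eq_ordered_word:
  assumes "w \<in> lists {1..n}"
  obtains \<alpha> where "\<alpha> \<in> multi_indices n" "sort w = ordered_word n \<alpha>"
proof
  let ?\<alpha> = "restrict (count (mset w)) {1..n}"
  show "?\<alpha> \<in> multi_indices n" by (simp add: multi_indices_def)
  have "mset (ordered_word n ?\<alpha>) = mset w"
  proof (rule multiset_eqI)
    fix i
    have "count (mset w) i = 0" if "i \<notin> {1..n}"
      using assms that by (auto simp: count_eq_zero_iff)
    then show "count (mset (ordered_word n ?\<alpha>)) i = count (mset w) i"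
      by (auto simp: count_ordered_word)
  qed
  then show "sort w = ordered_word n ?\<alpha>"
    by (intro properties_for_sort sorted_ordered_word)
qed

text \<open>An average of elements congruent to \<open>q\<close> modulo a subspace is congruent to \<open>q\<close>. The number
  \<open>m!\<close> of permutations has to be invertible for this.\<close>

lemma linear_image_Sym_congruent:
  fixes f :: "'k::field_char_0 ncpoly \<Rightarrow> 'k ncpoly"
  assumes f: "Vector_Spaces.linear ncpoly_smult ncpoly_smult f" and S: "ncpoly.subspace S"
    and words: "\<And>\<sigma>. \<sigma> permutes {..<length w} \<Longrightarrow> f (monomial (permute_list \<sigma> w)) - q \<in> S"
  shows "f (Sym w) - q \<in> S"
proof -
  interpret f: Vector_Spaces.linear ncpoly_smult ncpoly_smult f by (rule f)
  let ?P = "{\<sigma>. \<sigma> permutes {..<length w}}"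
  have "ncpoly_smult (1 / fact (length w)) (\<Sum>\<sigma>\<in>?P. q) = q"
  proof -
    have "(\<Sum>\<sigma>\<in>?P. q) = ncpoly_smult (fact (length w)) q"
      using card_permutations[of "{..<length w}" "length w"]
      by (simp only: ncpoly.sum_constant_scale finite_lessThan card_lessThan of_nat_fact simp_thms)
    then show ?thesis by simp
  qed
  then have "f (Sym w) - q = ncpoly_smult (1 / fact (length w)) (\<Sum>\<sigma>\<in>?P. f (monomial (permute_list \<sigma> w)) - q)"
    by (simp only: Sym_def f.scale f.sum sum_subtractf ncpoly.scale_right_diff_distrib)
  also have "\<dots> \<in> S"
    by (intro ncpoly.subspace_scale[OF S] ncpoly.subspace_sum[OF S] words) simp
  finally show ?thesis .
qed

lemma permute_list_in_lists:
  "\<sigma> permutes {..<length w} \<Longrightarrow> w \<in> lists A \<Longrightarrow> permute_list \<sigma> w \<in> lists A"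
  by (simp add: lists_eq_set)

lemma Sym_in_carrier:
  assumes "w \<in> lists {1..n}"
  shows "Sym w \<in> carrier (ncpoly_algebra n)"
proof -
  have "Sym w - 0 \<in> carrier (ncpoly_algebra n)"
    using assms
    by (intro linear_image_Sym_congruent[where f = "\<lambda>p. p"] ncpoly_linearI subspace_carrier)
      (simp_all only: diff_zero monomial_in_carrier permute_list_in_lists)
  then show ?thesis by simp
qed


section \<open>Bases of the universal enveloping algebra\<close>

context lie_algebra_basis
begin

lemma to_UEA_eq_zero_iff:
  assumes "p \<in> carrier (ncpoly_algebra n)"
  shows "to_UEA p = \<zero>\<^bsub>UEA\<^esub> \<longleftrightarrow> p \<in> relation_ideal"
proof -
  have "\<zero>\<^bsub>UEA\<^esub> = relation_ideal" by (simp add: UEA_sel FactRing_def)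
  then show ?thesis
    using ring.a_rcos_zero[OF ring_ncpoly_algebra ideal_relation_ideal]
      ideal.rcos_const_imp_mem[OF ideal_relation_ideal assms]
    by (auto simp: to_UEA_def)
qed

lemma to_UEA_relation_ideal: "p \<in> relation_ideal \<Longrightarrow> to_UEA p = \<zero>\<^bsub>UEA\<^esub>"
  using to_UEA_eq_zero_iff submodule_relation_ideal unfolding submodule_ncpoly_algebra_iff by blast

lemma to_UEA_in_carrier: "p \<in> carrier (ncpoly_algebra n) \<Longrightarrow> to_UEA p \<in> carrier UEA"
  by (simp add: carrier_UEA)

lemma to_UEA_sum:
  assumes "finite F" "\<And>\<alpha>. \<alpha> \<in> F \<Longrightarrow> p \<alpha> \<in> carrier (ncpoly_algebra n)"
  shows "to_UEA (\<Sum>\<alpha>\<in>F. ncpoly_smult (c \<alpha>) (p \<alpha>)) = (\<Oplus>\<^bsub>UEA\<^esub>\<alpha>\<in>F. c \<alpha> \<odot>\<^bsub>UEA\<^esub> to_UEA (p \<alpha>))"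
proof -
  interpret U: vectorspace class_ring UEA by (rule vectorspace_UEA)
  show ?thesis
    using assms
  proof (induction F rule: finite_induct)
    case empty
    then show ?case
      using to_UEA_relation_ideal[OF ncpoly.subspace_0[OF subspace_relation_ideal]] by simp
  next
    case (insert \<alpha> F)
    have [simp]: "ncpoly_smult (c \<beta>) (p \<beta>) \<in> carrier (ncpoly_algebra n)" if "\<beta> \<in> insert \<alpha> F" for \<beta>
      using insert.prems that ncpoly.subspace_scale[OF subspace_carrier] by blast
    have "(\<Sum>\<beta>\<in>F. ncpoly_smult (c \<beta>) (p \<beta>)) \<in> carrier (ncpoly_algebra n)"
      by (rule ncpoly.subspace_sum[OF subspace_carrier]) simp
    moreover have "c \<beta> \<odot>\<^bsub>UEA\<^esub> to_UEA (p \<beta>) \<in> carrier UEA" if "\<beta> \<in> insert \<alpha> F" for \<beta>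
      using insert.prems that by (intro U.smult_closed to_UEA_in_carrier) simp_all
    ultimately show ?case
      using insert by (simp add: to_UEA_add to_UEA_smult U.finsum_insert Pi_iff)
  qed
qed

text \<open>Transfers independence and generation from polynomials modulo the ideal to the quotient. Independence
  of the family over finite index sets also gives that the images are pairwise distinct.\<close>

lemma basis_family_UEA_if_basis_modulo_ideal:
  assumes p: "\<And>\<alpha>. \<alpha> \<in> J \<Longrightarrow> p \<alpha> \<in> carrier (ncpoly_algebra n)"
    and indep: "\<And>F c \<alpha>. finite F \<Longrightarrow> F \<subseteq> J \<Longrightarrow>
      (\<Sum>\<alpha>\<in>F. ncpoly_smult (c \<alpha>) (p \<alpha>)) \<in> relation_ideal \<Longrightarrow> \<alpha> \<in> F \<Longrightarrow> c \<alpha> = 0"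
    and gen: "carrier (ncpoly_algebra n) \<subseteq> ncpoly.span (relation_ideal \<union> p ` J)"
  shows "basis_family class_ring UEA J (\<lambda>\<alpha>. to_UEA (p \<alpha>))"
proof -
  interpret U: vectorspace class_ring UEA by (rule vectorspace_UEA)
  let ?b = "\<lambda>\<alpha>. to_UEA (p \<alpha>)"
  have b: "?b ` J \<subseteq> carrier UEA" using p by (auto simp: to_UEA_in_carrier)
  have zero: "\<alpha> \<in> F \<Longrightarrow> c \<alpha> = 0"
    if F: "finite F" "F \<subseteq> J" "(\<Oplus>\<^bsub>UEA\<^esub>\<alpha>\<in>F. c \<alpha> \<odot>\<^bsub>UEA\<^esub> ?b \<alpha>) = \<zero>\<^bsub>UEA\<^esub>" for F c \<alpha>
  proof -
    have pF: "p \<beta> \<in> carrier (ncpoly_algebra n)" if "\<beta> \<in> F" for \<beta> using p F(2) that by blast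
    have "(\<Sum>\<alpha>\<in>F. ncpoly_smult (c \<alpha>) (p \<alpha>)) \<in> carrier (ncpoly_algebra n)"
      by (intro ncpoly.subspace_sum[OF subspace_carrier] ncpoly.subspace_scale[OF subspace_carrier] pF)
    moreover have "to_UEA (\<Sum>\<alpha>\<in>F. ncpoly_smult (c \<alpha>) (p \<alpha>)) = \<zero>\<^bsub>UEA\<^esub>"
      using to_UEA_sum[of F p c] F(1,3) pF by simp
    ultimately have "(\<Sum>\<alpha>\<in>F. ncpoly_smult (c \<alpha>) (p \<alpha>)) \<in> relation_ideal"
      by (simp only: to_UEA_eq_zero_iff)
    then show "\<alpha> \<in> F \<Longrightarrow> c \<alpha> = 0" using indep F(1,2) by blast
  qed
  have inj: "inj_on ?b J"
  proof (rule inj_onI, rule ccontr)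
    fix \<alpha> \<beta> assume *: "\<alpha> \<in> J" "\<beta> \<in> J" "?b \<alpha> = ?b \<beta>" "\<alpha> \<noteq> \<beta>"
    have minus: "ncpoly_smult (- 1) (p \<gamma>) \<in> carrier (ncpoly_algebra n)" if "\<gamma> \<in> J" for \<gamma>
      using p[OF that] by (rule ncpoly.subspace_scale[OF subspace_carrier])
    have diff: "p \<alpha> + ncpoly_smult (- 1) (p \<beta>) \<in> carrier (ncpoly_algebra n)"
      using p minus * by (intro ncpoly.subspace_add[OF subspace_carrier])
    have "to_UEA (p \<alpha> + ncpoly_smult (- 1) (p \<beta>)) = to_UEA (p \<alpha> + ncpoly_smult (- 1) (p \<alpha>))"
      using p minus * by (simp only: to_UEA_add to_UEA_smult)
    also have "\<dots> = to_UEA 0" by simp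
    also have "\<dots> = \<zero>\<^bsub>UEA\<^esub>"
      by (rule to_UEA_relation_ideal[OF ncpoly.subspace_0[OF subspace_relation_ideal]])
    finally have "p \<alpha> + ncpoly_smult (- 1) (p \<beta>) \<in> relation_ideal"
      using diff to_UEA_eq_zero_iff by blast
    \<comment> \<open>If two images agree, then the difference of the two members is a nontrivial relation.\<close>
    then have "(\<Sum>\<gamma>\<in>{\<alpha>, \<beta>}. ncpoly_smult (if \<gamma> = \<alpha> then 1 else - 1) (p \<gamma>)) \<in> relation_ideal"
      using *(4) by simp
    from indep[OF _ _ this, of \<alpha>] * show False by simp
  qed
  have "U.lin_indpt (?b ` J)"
  proof
    assume "U.lin_dep (?b ` J)"
    then obtain A a v where A: "finite A" "A \<subseteq> ?b ` J" "U.lincomb a A = \<zero>\<^bsub>UEA\<^esub>" "v \<in> A" "a v \<noteq> 0"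
      unfolding U.lin_dep_def by auto
    define F where "F = {\<alpha> \<in> J. ?b \<alpha> \<in> A}"
    have F: "F \<subseteq> J" "?b ` F = A" "inj_on ?b F"
      using A(2) inj by (auto simp: F_def inj_on_def)
    then have "finite F" using A(1) finite_imageD by blast
    have "U.lincomb a A = (\<Oplus>\<^bsub>UEA\<^esub>v\<in>?b ` F. a v \<odot>\<^bsub>UEA\<^esub> v)"
      by (simp only: U.lincomb_def F(2))
    also have "\<dots> = (\<Oplus>\<^bsub>UEA\<^esub>\<alpha>\<in>F. a (?b \<alpha>) \<odot>\<^bsub>UEA\<^esub> ?b \<alpha>)"
      using F b by (intro U.finsum_reindex) (auto intro!: U.smult_closed)
    finally have "(\<Oplus>\<^bsub>UEA\<^esub>\<alpha>\<in>F. a (?b \<alpha>) \<odot>\<^bsub>UEA\<^esub> ?b \<alpha>) = \<zero>\<^bsub>UEA\<^esub>"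
      using A(3) by simp
    from zero[OF \<open>finite F\<close> F(1) this] A(4,5) F(2) show False by auto
  qed
  moreover have "U.gen_set (?b ` J)"
  proof
    show "U.span (?b ` J) \<subseteq> carrier UEA" by (rule U.span_is_subset2[OF b])
    have sub: "submodule class_ring (U.span (?b ` J)) UEA" by (rule U.span_is_submodule[OF b])
    show "carrier UEA \<subseteq> U.span (?b ` J)"
    proof
      fix u assume "u \<in> carrier UEA"
      then obtain q where q: "q \<in> carrier (ncpoly_algebra n)" "u = to_UEA q" by (auto simp: carrier_UEA)
      have "q \<in> ncpoly.span (relation_ideal \<union> p ` J)" using gen q(1) by blast
      then have "q \<in> carrier (ncpoly_algebra n) \<and> to_UEA q \<in> U.span (?b ` J)"
      proof (induction q rule: ncpoly.span_induct)
        case base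
        have "to_UEA 0 \<in> U.span (?b ` J)"
          unfolding to_UEA_relation_ideal[OF ncpoly.subspace_0[OF subspace_relation_ideal]]
          by (rule submodule.zero_closed[OF sub])
        then show ?case
          using ncpoly.subspace_add[OF subspace_carrier[of n]] ncpoly.subspace_scale[OF subspace_carrier[of n]]
            submodule.m_closed[OF sub] submodule.smult_closed[OF sub] ncpoly.subspace_0[OF subspace_carrier]
          by (auto simp: ncpoly.subspace_def to_UEA_add to_UEA_smult)
      next
        case (step q)
        then show ?case
        proof
          assume "q \<in> relation_ideal"
          moreover from this have "q \<in> carrier (ncpoly_algebra n)"
            using submodule_relation_ideal unfolding submodule_ncpoly_algebra_iff by blast
          ultimately show ?thesis
            using to_UEA_relation_ideal submodule.zero_closed[OF sub] by simp
        next
          assume "q \<in> p ` J"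
          then show ?thesis using p U.in_own_span[OF b] by blast
        qed
      qed
      then show "u \<in> U.span (?b ` J)" by (simp add: q(2))
    qed
  qed
  ultimately show ?thesis
    using inj b by (simp add: basis_family_def U.basis_def)
qed

lemma leading_word_monomial:
  assumes "w \<in> lists {1..n}" "equipollent w (ordered_word n \<alpha>)"
  shows "linear_extension normal_form (monomial w) - monomial (ordered_word n \<alpha>)
    \<in> shorter_polys (length (ordered_word n \<alpha>))"
proof -
  have "mset w = mset (ordered_word n \<alpha>)" using assms(2) by (simp add: equipollent_def)
  then have "sort w = ordered_word n \<alpha>" "length w = length (ordered_word n \<alpha>)"
    using sorted_ordered_word by (metis properties_for_sort, metis size_mset)
  then show ?thesis using normal_form_leading_word[OF assms(1)] by simp
qed

text \<open>Unitriangularity with respect to the ordered words, graded by length. Independence is read off at the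
  longest ordered word that belongs to a nonzero coefficient. Generation is an induction on the
  length of words, in which a word is traded for the member of the family with the same sorted word.\<close>

theorem basis_family_if_leading_word:
  assumes p: "\<And>\<alpha>. \<alpha> \<in> multi_indices n \<Longrightarrow> p \<alpha> \<in> carrier (ncpoly_algebra n)"
    and leading: "\<And>\<alpha>. \<alpha> \<in> multi_indices n \<Longrightarrow>
      linear_extension normal_form (p \<alpha>) - monomial (ordered_word n \<alpha>)
        \<in> shorter_polys (length (ordered_word n \<alpha>))"
  shows "basis_family class_ring UEA (multi_indices n) (\<lambda>\<alpha>. to_UEA (p \<alpha>))"
proof (rule basis_family_UEA_if_basis_modulo_ideal[OF p])
  let ?N = "linear_extension normal_form" and ?J = "multi_indices n" and ?o = "ordered_word n"
  interpret N: Vector_Spaces.linear ncpoly_smult ncpoly_smult ?N by (rule linear_linear_extension)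
  fix F c \<alpha>
  assume F: "finite F" "F \<subseteq> ?J" and rel: "(\<Sum>\<alpha>\<in>F. ncpoly_smult (c \<alpha>) (p \<alpha>)) \<in> relation_ideal"
    and "\<alpha> \<in> F"
  show "c \<alpha> = 0"
  proof (rule ccontr)
    assume "c \<alpha> \<noteq> 0"
    let ?G = "{\<alpha> \<in> F. c \<alpha> \<noteq> 0}"
    have "finite ((\<lambda>\<beta>. length (?o \<beta>)) ` ?G)" "(\<lambda>\<beta>. length (?o \<beta>)) ` ?G \<noteq> {}"
      using F(1) \<open>\<alpha> \<in> F\<close> \<open>c \<alpha> \<noteq> 0\<close> by auto
    then obtain \<mu> where \<mu>: "\<mu> \<in> ?G" "\<And>\<beta>. \<beta> \<in> ?G \<Longrightarrow> length (?o \<beta>) \<le> length (?o \<mu>)"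
      using Max_in Max_ge by (smt (verit, best) imageE image_eqI)
    \<comment> \<open>No other leading word equals that of \<open>\<mu>\<close>, and lower terms of members in the sum are too short.\<close>
    have coeff: "Poly_Mapping.lookup (?N (p \<beta>)) (?o \<mu>) = (if \<beta> = \<mu> then 1 else 0)"
      if "\<beta> \<in> ?G" for \<beta>
    proof -
      have "\<beta> \<in> ?J" "\<mu> \<in> ?J" using that \<mu>(1) F(2) by auto
      have "?o \<mu> \<notin> Poly_Mapping.keys (?N (p \<beta>) - monomial (?o \<beta>))"
        using leading[OF \<open>\<beta> \<in> ?J\<close>] \<mu>(2)[OF that] by (auto simp: shorter_polys_def)
      then have "Poly_Mapping.lookup (?N (p \<beta>)) (?o \<mu>) = Poly_Mapping.lookup (monomial (?o \<beta>)) (?o \<mu>)"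
        by (simp add: in_keys_iff lookup_minus)
      then show ?thesis
        using inj_onD[OF inj_on_ordered_word _ \<open>\<beta> \<in> ?J\<close> \<open>\<mu> \<in> ?J\<close>]
        by (auto simp: monomial_def lookup_single when_def)
    qed
    have "0 = Poly_Mapping.lookup (?N (\<Sum>\<alpha>\<in>F. ncpoly_smult (c \<alpha>) (p \<alpha>))) (?o \<mu>)"
      using normal_form_relation_ideal[OF rel] by simp
    also have "\<dots> = (\<Sum>\<beta>\<in>F. c \<beta> * Poly_Mapping.lookup (?N (p \<beta>)) (?o \<mu>))"
      by (simp add: N.sum N.scale lookup_sum)
    also have "\<dots> = (\<Sum>\<beta>\<in>F. if \<beta> = \<mu> then c \<mu> else 0)"
    proof (rule sum.cong[OF refl])
      show "c \<beta> * Poly_Mapping.lookup (?N (p \<beta>)) (?o \<mu>) = (if \<beta> = \<mu> then c \<mu> else 0)" if "\<beta> \<in> F" for \<beta>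
        using coeff[of \<beta>] that by (cases "c \<beta> = 0") auto
    qed
    also have "\<dots> = c \<mu>" using \<mu>(1) F(1) by simp
    finally show False using \<mu>(1) by simp
  qed
next
  let ?N = "linear_extension normal_form" and ?J = "multi_indices n"
  let ?M = "ncpoly.span (relation_ideal \<union> p ` ?J)"
  have words: "monomial w \<in> ?M" if "w \<in> lists {1..n}" for w
    using that
  proof (induction w rule: length_induct)
    case (1 w)
    obtain \<alpha> where \<alpha>: "\<alpha> \<in> ?J" "sort w = ordered_word n \<alpha>"
      using sort_eq_ordered_word 1(2) by blast
    have shorter: "q \<in> ?M" if "q \<in> shorter_polys (length w)" for q
    proof -
      have "q = (\<Sum>u\<in>Poly_Mapping.keys q. ncpoly_smult (Poly_Mapping.lookup q u) (monomial u))"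
        by (simp add: sum_monomials)
      also have "\<dots> \<in> ?M"
        using that 1(1) by (intro ncpoly.span_sum ncpoly.span_scale) (auto simp: shorter_polys_def)
      finally show ?thesis .
    qed
    have "length (ordered_word n \<alpha>) = length w" using \<alpha>(2) by (metis length_sort)
    then have "?N (p \<alpha>) - monomial (ordered_word n \<alpha>) \<in> ?M" using leading[OF \<alpha>(1)] shorter by simp
    moreover have "normal_form w - monomial (ordered_word n \<alpha>) \<in> ?M"
      using normal_form_leading_word[OF 1(2)] shorter \<alpha>(2) by simp
    moreover have "monomial w - normal_form w \<in> ?M" "p \<alpha> - ?N (p \<alpha>) \<in> ?M" "p \<alpha> \<in> ?M"
      using monomial_minus_normal_form[OF 1(2)] minus_normal_form[OF p] \<alpha>(1)
      by (auto intro: ncpoly.span_base)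
    moreover have "a + b - c - d + e \<in> ?M"
      if "a \<in> ?M" "b \<in> ?M" "c \<in> ?M" "d \<in> ?M" "e \<in> ?M" for a b c d e
      using that by (intro ncpoly.span_add ncpoly.span_diff)
    \<comment> \<open>From \<open>w\<close> to its normal form, to its sorted word, to the normal form of \<open>p \<alpha>\<close> and to \<open>p \<alpha>\<close>, each step is in the span.\<close>
    ultimately have "(monomial w - normal_form w) + (normal_form w - monomial (ordered_word n \<alpha>))
        - (?N (p \<alpha>) - monomial (ordered_word n \<alpha>)) - (p \<alpha> - ?N (p \<alpha>)) + p \<alpha> \<in> ?M"
      by blast
    then show ?case by simp
  qed
  show "carrier (ncpoly_algebra n) \<subseteq> ?M"
  proof
    fix q :: "'k ncpoly" assume "q \<in> carrier (ncpoly_algebra n)"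
    then have "(\<Sum>u\<in>Poly_Mapping.keys q. ncpoly_smult (Poly_Mapping.lookup q u) (monomial u)) \<in> ?M"
      by (intro ncpoly.span_sum ncpoly.span_scale words) (auto simp: carrier_ncpoly_algebra)
    then show "q \<in> ?M" by (simp add: sum_monomials)
  qed
qed

end

theorem corollary3p12:
  fixes scale :: "'k::field_char_0 \<Rightarrow> 'l::ab_group_add \<Rightarrow> 'l"
    and bracket :: "'l \<Rightarrow> 'l \<Rightarrow> 'l"
    and n :: nat
    and X :: "nat \<Rightarrow> 'l"
  assumes "lie_algebra_basis scale bracket n X"
  shows
    "basis_family class_ring (lie_algebra_basis.UEA scale bracket n X) (multi_indices n)
       (\<lambda>\<alpha>. lie_algebra_basis.to_UEA scale bracket n X (Sym (ordered_word n \<alpha>)))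
     \<and> (\<forall>w :: (nat \<Rightarrow> nat) \<Rightarrow> nat list.
          (\<forall>\<alpha>\<in>multi_indices n. w \<alpha> \<in> lists {1..n} \<and> equipollent (w \<alpha>) (ordered_word n \<alpha>)) \<longrightarrow>
          basis_family class_ring (lie_algebra_basis.UEA scale bracket n X) (multi_indices n)
            (\<lambda>\<alpha>. lie_algebra_basis.to_UEA scale bracket n X (monomial (w \<alpha>))))
     \<and> basis_family class_ring (lie_algebra_basis.UEA scale bracket n X) (multi_indices n)
         (\<lambda>\<alpha>. lie_algebra_basis.to_UEA scale bracket n X (monomial (ordered_word n \<alpha>)))"
proof -
  interpret lie_algebra_basis scale bracket n X by (rule assms)
  have chosen: "basis_family class_ring UEA (multi_indices n) (\<lambda>\<alpha>. to_UEA (monomial (w \<alpha>)))"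
    if "\<forall>\<alpha>\<in>multi_indices n. w \<alpha> \<in> lists {1..n} \<and> equipollent (w \<alpha>) (ordered_word n \<alpha>)" for w
    using that by (intro basis_family_if_leading_word leading_word_monomial monomial_in_carrier) blast+
  moreover have "basis_family class_ring UEA (multi_indices n) (\<lambda>\<alpha>. to_UEA (monomial (ordered_word n \<alpha>)))"
    by (intro chosen ballI conjI ordered_word_in_lists) (simp add: equipollent_def)
  moreover have "basis_family class_ring UEA (multi_indices n) (\<lambda>\<alpha>. to_UEA (Sym (ordered_word n \<alpha>)))"
  proof (rule basis_family_if_leading_word)
    show "Sym (ordered_word n \<alpha>) \<in> carrier (ncpoly_algebra n)" for \<alpha>
      by (rule Sym_in_carrier[OF ordered_word_in_lists])
    show "linear_extension normal_form (Sym (ordered_word n \<alpha>)) - monomial (ordered_word n \<alpha>)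
        \<in> shorter_polys (length (ordered_word n \<alpha>))" for \<alpha>
    proof (rule linear_image_Sym_congruent[OF linear_linear_extension subspace_shorter_polys leading_word_monomial])
      fix \<sigma> assume \<sigma>: "\<sigma> permutes {..<length (ordered_word n \<alpha>)}"
      then show "permute_list \<sigma> (ordered_word n \<alpha>) \<in> lists {1..n}"
        by (rule permute_list_in_lists[OF _ ordered_word_in_lists])
      show "equipollent (permute_list \<sigma> (ordered_word n \<alpha>)) (ordered_word n \<alpha>)"
        using \<sigma> by (simp add: equipollent_def)
    qed
  qed
  ultimately show ?thesis by blast
qed

end
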